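(* Let $n\geq 3$. The base-cobase graph $G(\mathcal{W}^n,(\mathcal{W}^n)^\ast)$ of the whirl $\mathcal{W}^n$ is Hamiltonian connected, i.e. for any two distinct vertices $u,v$ it has a Hamiltonian path with endpoints $u$ and $v$.
   Context: The wheel graph $\mathcal{W}_n$ ($n\ge 3$) has vertices $c,v_1,\dots,v_n$, rim edges $v_iv_{i+1}$ (indices mod $n$) and spokes $cv_i$. The whirl $\mathcal{W}^n$ is the matroid on the edge set of $\mathcal{W}_n$ whose bases are the edge sets of spanning trees of $\mathcal{W}_n$ together with the set of all $n$ rim edges. For a matroid $M$ on $E$, a base-cobase is a base $B$ such that $E\setminus B$ is also a base; the base-cobase graph $G(M,M^\ast)$ has the base-cobases as vertices, two being adjacent iff their symmetric difference has exactly two elements. *)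

theory Defs
  imports Main
begin

section \<open>Simple graphs, with edges as two-element vertex sets\<close>

record 'v sgraph =
  verts :: "'v set"
  edges :: "'v set set"

definition is_path :: "'v sgraph \<Rightarrow> 'v list \<Rightarrow> bool" where
  "is_path G p \<longleftrightarrow> p \<noteq> [] \<and> set p \<subseteq> verts G \<and> distinct p
     \<and> successively (\<lambda>x y. {x, y} \<in> edges G) p"

definition path_between :: "'v sgraph \<Rightarrow> 'v \<Rightarrow> 'v \<Rightarrow> 'v list \<Rightarrow> bool" where
  "path_between G u v p \<longleftrightarrow> is_path G p \<and> hd p = u \<and> last p = v"

definition is_cycle :: "'v sgraph \<Rightarrow> 'v list \<Rightarrow> bool" where
  "is_cycle G p \<longleftrightarrow> is_path G p \<and> 3 \<le> length p \<and> {last p, hd p} \<in> edges G"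

definition is_tree :: "'v sgraph \<Rightarrow> bool" where
  "is_tree G \<longleftrightarrow> verts G \<noteq> {}
     \<and> (\<forall>u\<in>verts G. \<forall>v\<in>verts G. \<exists>p. path_between G u v p)
     \<and> (\<nexists>p. is_cycle G p)"

definition spanning_trees :: "'v sgraph \<Rightarrow> 'v set set set" where
  "spanning_trees G = {T. T \<subseteq> edges G \<and> is_tree \<lparr>verts = verts G, edges = T\<rparr>}"

definition hamiltonian_path :: "'v sgraph \<Rightarrow> 'v \<Rightarrow> 'v \<Rightarrow> 'v list \<Rightarrow> bool" where
  "hamiltonian_path G u v p \<longleftrightarrow> path_between G u v p \<and> set p = verts G"

definition hamiltonian_connected :: "'v sgraph \<Rightarrow> bool" where
  "hamiltonian_connected G \<longleftrightarrow>
     (\<forall>u\<in>verts G. \<forall>v\<in>verts G. u \<noteq> v \<longrightarrow> (\<exists>p. hamiltonian_path G u v p))"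


section \<open>Base-cobase graphs\<close>

text \<open>A matroid is given by its ground set and its family of bases. The exchange axiom is not
  part of the type, since none of the notions below refers to it.\<close>

record 'e matroid =
  ground :: "'e set"
  bases :: "'e set set"

definition base_cobases :: "'e matroid \<Rightarrow> 'e set set" where
  "base_cobases M = {B \<in> bases M. ground M - B \<in> bases M}"

definition base_cobase_graph :: "'e matroid \<Rightarrow> 'e set sgraph" where
  "base_cobase_graph M =
     \<lparr>verts = base_cobases M,
      edges = {{A, B} | A B. A \<in> base_cobases M \<and> B \<in> base_cobases M
                             \<and> card (sym_diff A B) = 2}\<rparr>"


section \<open>Wheels and whirls\<close>

text \<open>The rim vertices \<open>v\<^sub>1, \<dots>, v\<^sub>n\<close> are indexed from 0 here.\<close>

datatype wheel_vertex = Hub | Rim nat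

definition rim_edges :: "nat \<Rightarrow> wheel_vertex set set" where
  "rim_edges n = {{Rim i, Rim (Suc i mod n)} | i. i < n}"

definition spokes :: "nat \<Rightarrow> wheel_vertex set set" where
  "spokes n = {{Hub, Rim i} | i. i < n}"

definition wheel :: "nat \<Rightarrow> wheel_vertex sgraph" where
  "wheel n = \<lparr>verts = insert Hub (Rim ` {..<n}), edges = rim_edges n \<union> spokes n\<rparr>"

definition whirl :: "nat \<Rightarrow> wheel_vertex set matroid" where
  "whirl n = \<lparr>ground = edges (wheel n),
              bases = insert (rim_edges n) (spanning_trees (wheel n))\<rparr>"

end

theory Submission
  imports Defs
begin

text \<open>
  A base-cobase of the whirl is determined by its set \<open>S\<close> of spokes and one bit: excluding
  cycles through the hub in the base and in its complement forces every rim vertex without a spoke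
  to use the rim edge to its successor, or every one to use the edge to its predecessor. For a
  fixed bit, exchanging a spoke with a rim edge changes \<open>S\<close> by one element, so the graph consists of two
  \<open>n\<close>-cubes glued at \<open>S = {}\<close> and at the full set, plus some edges between the two cubes.

  The sets \<open>S\<close> avoiding the last rim vertex give two \<open>(n - 1)\<close>-cubes glued at \<open>{}\<close> only, and the
  remaining base-cobases are their complements. Two \<open>m\<close>-cubes glued at \<open>{}\<close> are Hamiltonian
  connected, by paths which traverse an edge of each cube: for \<open>m = 2\<close> three edges between the
  cubes suffice, and going from \<open>m\<close> to \<open>m + 1\<close> attaches two further \<open>m\<close>-cubes, one after the
  other. A cube has Hamiltonian paths between any two vertices of opposite parity, so a traversed
  edge can be replaced with a detour through the new cube. The two complementary halves are joined
  in the same way.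
\<close>

section \<open>Hamiltonian paths and their edges\<close>

fun path_edges :: "'a list \<Rightarrow> 'a set set" where
  "path_edges (x # y # zs) = insert {x, y} (path_edges (y # zs))"
| "path_edges _ = {}"

text \<open>\<open>E\<close> may contain edges leaving \<open>V\<close>, so that one edge set serves all vertex sets.\<close>

abbreviation hpath :: "'a set set \<Rightarrow> 'a set \<Rightarrow> 'a \<Rightarrow> 'a \<Rightarrow> 'a list \<Rightarrow> bool" where
  "hpath E V \<equiv> hamiltonian_path \<lparr>verts = V, edges = E\<rparr>"

lemma successively_iff_path_edges: "successively (\<lambda>x y. {x, y} \<in> E) p \<longleftrightarrow> path_edges p \<subseteq> E"
  by (induction p rule: path_edges.induct) auto

lemma hpath_iff:
  "hpath E V u v p \<longleftrightarrow>
     p \<noteq> [] \<and> distinct p \<and> set p = V \<and> hd p = u \<and> last p = v \<and> path_edges p \<subseteq> E"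
  by (auto simp: hamiltonian_path_def path_between_def is_path_def successively_iff_path_edges)

lemma path_edges_append:
  "p \<noteq> [] \<Longrightarrow> q \<noteq> [] \<Longrightarrow>
     path_edges (p @ q) = insert {last p, hd q} (path_edges p \<union> path_edges q)"
proof (induction p rule: path_edges.induct)
  case ("2_2" x)
  then show ?case by (cases q) auto
qed auto

lemma path_edges_rev: "path_edges (rev p) = path_edges p"
proof (induction p rule: path_edges.induct)
  case (1 x y zs)
  have "path_edges (rev (x # y # zs)) = path_edges (rev (y # zs) @ [x])" by simp
  also have "\<dots> = insert {y, x} (path_edges (rev (y # zs)))"
    by (subst path_edges_append) (auto simp: last_rev)
  finally show ?case using 1 by (simp add: insert_commute)
qed auto

lemma path_edges_map: "path_edges (map f p) = (`) f ` path_edges p"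
  by (induction p rule: path_edges.induct) auto

lemma path_edges_split:
  assumes "e \<in> path_edges p"
  obtains ps qs where "p = ps @ qs" "ps \<noteq> []" "qs \<noteq> []" "e = {last ps, hd qs}"
  using assms
proof (induction p arbitrary: thesis rule: path_edges.induct)
  case (1 x y zs)
  show ?case
  proof (cases "e \<in> path_edges (y # zs)")
    case True
    then obtain ps qs where "y # zs = ps @ qs" "ps \<noteq> []" "qs \<noteq> []" "e = {last ps, hd qs}"
      using "1.IH" by blast
    then show ?thesis using "1.prems"(1)[of "x # ps" qs] by simp
  next
    case False
    then show ?thesis using "1.prems"(1)[of "[x]" "y # zs"] "1.prems"(2) by simp
  qed
qed auto

lemma hpath_ends: "hpath E V u v p \<Longrightarrow> u \<in> V \<and> v \<in> V"
  by (auto simp: hpath_iff)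

lemma hpath_edges: "hpath E V u v p \<Longrightarrow> path_edges p \<subseteq> E"
  by (simp add: hpath_iff)

lemma hpath_edges_nonempty: "hpath E V u v p \<Longrightarrow> u \<noteq> v \<Longrightarrow> path_edges p \<noteq> {}"
  by (cases p rule: path_edges.cases) (auto simp: hpath_iff)

lemma hpath_mono: "hpath E V u v p \<Longrightarrow> E \<subseteq> E' \<Longrightarrow> hpath E' V u v p"
  by (auto simp: hpath_iff)

lemma hpath_rev: "hpath E V u v p \<Longrightarrow> hpath E V v u (rev p)"
  by (auto simp: hpath_iff path_edges_rev hd_rev last_rev)

lemma hpath_map:
  assumes "hpath E V u v p" "inj_on f V" "\<And>e. e \<in> E \<Longrightarrow> f ` e \<in> E'"
  shows "hpath E' (f ` V) (f u) (f v) (map f p)"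
  using assms by (auto simp: hpath_iff distinct_map hd_map last_map path_edges_map)

lemma hpath_append:
  assumes "hpath E V u x p" "hpath E W y v q" "V \<inter> W = {}" "{x, y} \<in> E"
  shows "hpath E (V \<union> W) u v (p @ q)" "path_edges p \<union> path_edges q \<subseteq> path_edges (p @ q)"
  using assms by (auto simp: hpath_iff path_edges_append)

lemma hpath_appendD:
  assumes "hpath E V u v (p @ q)" "p \<noteq> []" "q \<noteq> []"
  shows "hpath E (set p) u (last p) p" "hpath E (set q) (hd q) v q"
    "V = set p \<union> set q" "set p \<inter> set q = {}"
  using assms by (auto simp: hpath_iff path_edges_append)

lemma hpath_split:
  assumes p: "hpath E V u v p" and w: "w \<in> V" "w \<noteq> u"
  obtains V1 V2 x p1 p2 where "hpath E V1 u x p1" "hpath E V2 w v p2" "V = V1 \<union> V2"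
    "V1 \<inter> V2 = {}"
proof -
  obtain p1 p2 where split: "p = p1 @ w # p2" using p w(1) by (metis hpath_iff split_list)
  then have "p1 \<noteq> []" using p w(2) by (auto simp: hpath_iff)
  note parts = hpath_appendD[OF p[unfolded split] this list.distinct(2)]
  show thesis using that[OF parts(1) _ parts(3,4)] parts(2) by simp
qed

lemma hpath_detour:
  assumes p: "hpath E V u v p" and ab: "{a, b} \<in> path_edges p" and q: "hpath E W a' b' q"
    and E: "{a, a'} \<in> E" "{b, b'} \<in> E" and disj: "V \<inter> W = {}"
  obtains r where "hpath E (V \<union> W) u v r" "path_edges p - {{a, b}} \<union> path_edges q \<subseteq> path_edges r"
proof -
  obtain p1 p2 where split: "p = p1 @ p2" "p1 \<noteq> []" "p2 \<noteq> []" "{a, b} = {last p1, hd p2}"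
    using path_edges_split[OF ab] .
  note parts = hpath_appendD[OF p[unfolded split(1)] split(2,3)]
  have p_edges: "path_edges p = insert {a, b} (path_edges p1 \<union> path_edges p2)"
    using path_edges_append[OF split(2,3)] split(1,4) by simp
  note path = that
  have insert_path: thesis
    if q': "hpath E W x y q'" "path_edges q' = path_edges q" "{last p1, x} \<in> E" "{y, hd p2} \<in> E"
    for x y q'
  proof -
    have disj': "set p1 \<inter> (W \<union> set p2) = {}" "W \<inter> set p2 = {}" using parts(3,4) disj by blast+
    note q'p2 = hpath_append[OF q'(1) parts(2) disj'(2) q'(4)]
    note r = hpath_append[OF parts(1) q'p2(1) disj'(1) q'(3)]
    have "set p1 \<union> (W \<union> set p2) = V \<union> W" using parts(3) by blast
    then have "hpath E (V \<union> W) u v (p1 @ q' @ p2)" using r(1) by simp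
    moreover have "path_edges p - {{a, b}} \<union> path_edges q \<subseteq> path_edges (p1 @ q' @ p2)"
      using r(2) q'p2(2) q'(2) p_edges by blast
    ultimately show thesis by (rule path)
  qed
  consider "a = last p1" "b = hd p2" | "a = hd p2" "b = last p1"
    using split(4) by (auto simp: doubleton_eq_iff)
  then show thesis
  proof cases
    case 1
    then show thesis using insert_path[OF q refl] E by (simp add: insert_commute)
  next
    case 2
    then show thesis using insert_path[OF hpath_rev[OF q] path_edges_rev] E
      by (simp add: insert_commute)
  qed
qed

section \<open>Laceability of cubes\<close>

definition bicoloured :: "('k \<Rightarrow> 'a) \<Rightarrow> 'k set \<Rightarrow> ('k \<Rightarrow> 'c) \<Rightarrow> 'a set set" where
  "bicoloured f K c = {{f x, f y} | x y. x \<in> K \<and> y \<in> K \<and> c x \<noteq> c y}"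

lemma bicolouredE:
  assumes "A \<inter> bicoloured f K c \<noteq> {}"
  obtains x y where "{f x, f y} \<in> A" "x \<in> K" "y \<in> K" "c x \<noteq> c y"
  using assms unfolding bicoloured_def by blast

text \<open>\<open>K\<close> labels the vertices, so that several copies of a graph share one colouring.\<close>

definition laceable :: "'a set set \<Rightarrow> ('k \<Rightarrow> 'a) \<Rightarrow> 'k set \<Rightarrow> ('k \<Rightarrow> 'c) \<Rightarrow> bool" where
  "laceable E f K c \<longleftrightarrow> inj_on f K \<and> (\<forall>x \<in> K. \<forall>y \<in> K. c x \<noteq> c y \<longrightarrow>
     (\<exists>p. hpath (E \<inter> bicoloured f K c) (f ` K) (f x) (f y) p))"

lemma laceable_path:
  assumes "laceable E f K c" "x \<in> K" "y \<in> K" "c x \<noteq> c y"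
  obtains p where "hpath E (f ` K) (f x) (f y) p" "path_edges p \<subseteq> bicoloured f K c"
    "path_edges p \<noteq> {}"
proof -
  obtain p where p: "hpath (E \<inter> bicoloured f K c) (f ` K) (f x) (f y) p"
    using assms unfolding laceable_def by blast
  moreover have "f x \<noteq> f y" using assms by (auto simp: laceable_def dest: inj_onD)
  ultimately show thesis
    using that hpath_mono[OF p] hpath_edges[OF p] hpath_edges_nonempty[OF p] by blast
qed

lemma laceable_prism_same_side:
  assumes f: "laceable E f K c" and g: "laceable E g K c" and disj: "f ` K \<inter> g ` K = {}"
    and rungs: "\<And>x. x \<in> K \<Longrightarrow> {f x, g x} \<in> E"
    and xy: "x \<in> K" "y \<in> K" "c x \<noteq> c y"
  shows "\<exists>p. hpath E (f ` K \<union> g ` K) (f x) (f y) p"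
proof -
  obtain p where p: "hpath E (f ` K) (f x) (f y) p" "path_edges p \<subseteq> bicoloured f K c"
    "path_edges p \<noteq> {}" using laceable_path[OF f xy] .
  then have "path_edges p \<inter> bicoloured f K c \<noteq> {}" by blast
  then obtain a b where ab: "{f a, f b} \<in> path_edges p" "a \<in> K" "b \<in> K" "c a \<noteq> c b"
    by (rule bicolouredE)
  obtain q where "hpath E (g ` K) (g a) (g b) q" using laceable_path[OF g ab(2-4)] .
  from hpath_detour[OF p(1) ab(1) this rungs rungs disj] show ?thesis using ab by blast
qed

lemma laceable_prism_opposite_sides:
  assumes f: "laceable E f K c" and g: "laceable E g K c" and disj: "f ` K \<inter> g ` K = {}"
    and rungs: "\<And>x. x \<in> K \<Longrightarrow> {f x, g x} \<in> E"
    and xy: "x \<in> K" "y \<in> K" "c x = c y" and K: "K = {x} \<or> (\<exists>z \<in> K. c z \<noteq> c x)"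
  shows "\<exists>p. hpath E (f ` K \<union> g ` K) (f x) (g y) p"
proof (cases "K = {x}")
  case True
  then have "hpath E (f ` K \<union> g ` K) (f x) (g y) [f x, g y]"
    using xy disj rungs[of x] by (auto simp: hpath_iff)
  then show ?thesis ..
next
  case False
  then obtain z where z: "z \<in> K" "c x \<noteq> c z" "c z \<noteq> c y" using K xy by force
  obtain p where p: "hpath E (f ` K) (f x) (f z) p" using laceable_path[OF f xy(1) z(1,2)] .
  obtain q where q: "hpath E (g ` K) (g z) (g y) q" using laceable_path[OF g z(1) xy(2) z(3)] .
  show ?thesis using hpath_append(1)[OF p q disj rungs[OF z(1)]] ..
qed

definition even_card :: "'i set \<Rightarrow> bool" where
  "even_card S \<longleftrightarrow> even (card S)"

lemma even_card_insert: "finite S \<Longrightarrow> i \<notin> S \<Longrightarrow> even_card (insert i S) \<longleftrightarrow> \<not> even_card S"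
  by (simp add: even_card_def)

definition cube_edges :: "('i set \<Rightarrow> 'a) \<Rightarrow> 'i set \<Rightarrow> 'a set set" where
  "cube_edges f A = {{f S, f (insert i S)} | S i. S \<subseteq> A \<and> i \<in> A - S}"

lemma cube_edgesI: "S \<subseteq> A \<Longrightarrow> i \<in> A - S \<Longrightarrow> {f S, f (insert i S)} \<in> cube_edges f A"
  by (auto simp: cube_edges_def)

lemma cube_edges_bicoloured:
  assumes "finite A"
  shows "cube_edges f A \<subseteq> bicoloured f (Pow A) even_card"
proof
  fix e assume "e \<in> cube_edges f A"
  then obtain S i where e: "e = {f S, f (insert i S)}" "S \<subseteq> A" "i \<in> A - S"
    by (auto simp: cube_edges_def)
  then have "even_card S \<noteq> even_card (insert i S)"
    using even_card_insert[of S i] finite_subset[OF _ assms] by auto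
  then show "e \<in> bicoloured f (Pow A) even_card" using e unfolding bicoloured_def by blast
qed

lemma cube_edges_mono: "A \<subseteq> B \<Longrightarrow> cube_edges f A \<subseteq> cube_edges f B"
  unfolding cube_edges_def by blast

lemma cube_edges_insert: "a \<notin> A \<Longrightarrow> cube_edges (f \<circ> insert a) A \<subseteq> cube_edges f (insert a A)"
proof
  fix e assume a: "a \<notin> A" and "e \<in> cube_edges (f \<circ> insert a) A"
  then obtain S i where "e = {f (insert a S), f (insert i (insert a S))}" "S \<subseteq> A" "i \<in> A - S"
    by (auto simp: cube_edges_def insert_commute)
  then show "e \<in> cube_edges f (insert a A)"
    using a cube_edgesI[of "insert a S" "insert a A" i f] by auto
qed

lemma image_Pow_insert: "f ` Pow (insert a A) = f ` Pow A \<union> (f \<circ> insert a) ` Pow A"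
  by (simp add: Pow_insert image_Un image_comp)

lemma inj_on_Pow_insert:
  assumes "inj_on f (Pow (insert a A))" "a \<notin> A"
  shows "inj_on f (Pow A)" "inj_on (f \<circ> insert a) (Pow A)"
    "f ` Pow A \<inter> (f \<circ> insert a) ` Pow A = {}"
proof -
  show "inj_on f (Pow A)" using assms(1) by (rule inj_on_subset) auto
  have "inj_on (insert a) (Pow A)"
    using assms(2) by (auto simp: inj_on_def insert_ident subset_iff)
  then show "inj_on (f \<circ> insert a) (Pow A)"
    by (rule comp_inj_on) (rule inj_on_subset[OF assms(1)], auto)
  show "f ` Pow A \<inter> (f \<circ> insert a) ` Pow A = {}"
    using assms by (auto dest!: inj_onD[of f])
qed

lemma subset_insert_cases:
  assumes "S \<subseteq> insert a A"
  obtains "S \<subseteq> A" | T where "S = insert a T" "T \<subseteq> A"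
  using assms by (metis subset_insert_iff insert_Diff)

lemma laceable_mono: "laceable E f K c \<Longrightarrow> E \<subseteq> E' \<Longrightarrow> laceable E' f K c"
  unfolding laceable_def by (meson Int_mono hpath_mono order_refl)

lemma ex_opposite_parity:
  assumes "S \<subseteq> A"
  shows "Pow A = {S} \<or> (\<exists>T \<in> Pow A. even_card T \<noteq> even_card S)"
proof (cases "A = {}")
  case False
  then obtain i where "{i} \<in> Pow A" by blast
  moreover have "even_card {}" "\<not> even_card {i}" by (simp_all add: even_card_def)
  ultimately show ?thesis by (metis Pow_bottom)
qed (use assms in simp)

lemma hpath_cube_insert:
  assumes A: "finite A" "a \<notin> A" and f: "inj_on f (Pow (insert a A))"
    and E: "cube_edges f (insert a A) \<subseteq> E"
    and lower: "laceable E f (Pow A) even_card"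
    and upper: "laceable E (f \<circ> insert a) (Pow A) even_card"
    and ST: "S \<subseteq> insert a A" "T \<subseteq> insert a A" "even_card S \<noteq> even_card T"
  shows "\<exists>p. hpath E (f ` Pow (insert a A)) (f S) (f T) p"
proof -
  let ?f' = "f \<circ> insert a"
  have disj: "f ` Pow A \<inter> ?f' ` Pow A = {}" "?f' ` Pow A \<inter> f ` Pow A = {}"
    using inj_on_Pow_insert(3)[OF f A(2)] by blast+
  have rungs: "{f S, ?f' S} \<in> E" "{?f' S, f S} \<in> E" if "S \<in> Pow A" for S
    using cube_edgesI[of S "insert a A" a f] E that A(2) by (auto simp: insert_commute)
  have flip: "even_card (insert a S) \<longleftrightarrow> \<not> even_card S" if "S \<subseteq> A" for S
    using that A(2) finite_subset[OF _ A(1)] by (intro even_card_insert) auto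
  have opposite: "\<exists>p. hpath E (f ` Pow (insert a A)) (f S) (f (insert a T)) p"
    if "S \<subseteq> A" "T \<subseteq> A" "even_card S = even_card T" for S T
    using laceable_prism_opposite_sides[OF lower upper disj(1) rungs(1), of S T]
      ex_opposite_parity[of S A] that unfolding image_Pow_insert by simp
  show ?thesis
  proof (rule subset_insert_cases[OF ST(1)]; rule subset_insert_cases[OF ST(2)])
    assume "S \<subseteq> A" "T \<subseteq> A"
    then show ?thesis
      using laceable_prism_same_side[OF lower upper disj(1) rungs(1), of S T] ST(3)
      unfolding image_Pow_insert by simp
  next
    fix T' assume "S \<subseteq> A" "T = insert a T'" "T' \<subseteq> A"
    then show ?thesis using opposite[of S T'] ST(3) flip by simp
  next
    fix S' assume "S = insert a S'" "S' \<subseteq> A" "T \<subseteq> A"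
    then obtain p where "hpath E (f ` Pow (insert a A)) (f T) (f S) p"
      using opposite[of T S'] ST(3) flip by auto
    from hpath_rev[OF this] show ?thesis ..
  next
    fix S' T' assume "S = insert a S'" "S' \<subseteq> A" "T = insert a T'" "T' \<subseteq> A"
    then show ?thesis
      using laceable_prism_same_side[OF upper lower disj(2) rungs(2), of S' T'] ST(3) flip
      unfolding image_Pow_insert by (simp add: Un_commute)
  qed
qed

lemma laceable_cube:
  assumes "finite A" "inj_on f (Pow A)" "cube_edges f A \<subseteq> E"
  shows "laceable E f (Pow A) even_card"
  using assms
proof (induction A arbitrary: f E rule: finite_induct)
  case empty
  then show ?case by (simp add: laceable_def)
next
  case (insert a A)
  let ?C = "cube_edges f (insert a A)" and ?B = "bicoloured f (Pow (insert a A)) even_card"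
  note inj = inj_on_Pow_insert[OF insert.prems(1) insert.hyps(2)]
  have lower: "laceable ?C f (Pow A) even_card"
    by (rule insert.IH[OF inj(1) cube_edges_mono]) blast
  have upper: "laceable ?C (f \<circ> insert a) (Pow A) even_card"
    by (rule insert.IH[OF inj(2) cube_edges_insert[OF insert.hyps(2)]])
  have "?C \<subseteq> ?B" using insert.hyps(1) by (intro cube_edges_bicoloured) simp
  then have "?C \<subseteq> ?C \<inter> ?B" by blast
  note cube_path = hpath_cube_insert[OF insert.hyps insert.prems(1) order_refl lower upper]
  have "laceable ?C f (Pow (insert a A)) even_card"
    unfolding laceable_def
  proof (intro conjI ballI impI insert.prems(1))
    fix S T assume "S \<in> Pow (insert a A)" "T \<in> Pow (insert a A)" "even_card S \<noteq> even_card T"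
    then obtain p where "hpath ?C (f ` Pow (insert a A)) (f S) (f T) p" using cube_path by blast
    from hpath_mono[OF this \<open>?C \<subseteq> ?C \<inter> ?B\<close>]
    show "\<exists>p. hpath (?C \<inter> ?B) (f ` Pow (insert a A)) (f S) (f T) p" ..
  qed
  then show ?case using insert.prems(2) by (rule laceable_mono)
qed

section \<open>Hamiltonian connectedness through prescribed edges\<close>

definition joined_through :: "'a set set \<Rightarrow> 'a set \<Rightarrow> 'a set set set \<Rightarrow> 'a \<Rightarrow> 'a \<Rightarrow> bool" where
  "joined_through E V \<F> u v \<longleftrightarrow> (\<exists>p. hpath E V u v p \<and> (\<forall>F \<in> \<F>. path_edges p \<inter> F \<noteq> {}))"

definition ham_connected_through :: "'a set set \<Rightarrow> 'a set \<Rightarrow> 'a set set set \<Rightarrow> bool" where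
  "ham_connected_through E V \<F> \<longleftrightarrow> (\<forall>u \<in> V. \<forall>v \<in> V. u \<noteq> v \<longrightarrow> joined_through E V \<F> u v)"

lemma joined_throughI:
  "\<lbrakk>hpath E V u v p; \<And>F. F \<in> \<F> \<Longrightarrow> path_edges p \<inter> F \<noteq> {}\<rbrakk> \<Longrightarrow> joined_through E V \<F> u v"
  unfolding joined_through_def by blast

lemma joined_through_sym:
  assumes "joined_through E V \<F> u v"
  shows "joined_through E V \<F> v u"
proof -
  obtain p where "hpath E V u v p" "\<forall>F \<in> \<F>. path_edges p \<inter> F \<noteq> {}"
    using assms unfolding joined_through_def by blast
  then show ?thesis
    by (intro joined_throughI[where p = "rev p"]) (simp_all add: hpath_rev path_edges_rev)
qed

lemma ham_connected_through_path:
  assumes "ham_connected_through E V \<F>" "u \<in> V" "v \<in> V" "u \<noteq> v"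
  obtains p where "hpath E V u v p" "\<forall>F \<in> \<F>. path_edges p \<inter> F \<noteq> {}"
  using assms unfolding ham_connected_through_def joined_through_def by metis

lemma ham_connected_through_UnI:
  assumes "\<And>u v. \<lbrakk>u \<in> V; v \<in> V; u \<noteq> v\<rbrakk> \<Longrightarrow> joined_through E (V \<union> W) \<F> u v"
    and "\<And>u v. \<lbrakk>u \<in> V; v \<in> W\<rbrakk> \<Longrightarrow> joined_through E (V \<union> W) \<F> u v"
    and "\<And>u v. \<lbrakk>u \<in> W; v \<in> W; u \<noteq> v\<rbrakk> \<Longrightarrow> joined_through E (V \<union> W) \<F> u v"
  shows "ham_connected_through E (V \<union> W) \<F>"
  using assms assms(2)[THEN joined_through_sym] unfolding ham_connected_through_def by blast

lemma ham_connected_through_mono: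
  "ham_connected_through E V \<F> \<Longrightarrow> \<G> \<subseteq> \<F> \<Longrightarrow> ham_connected_through E V \<G>"
  unfolding ham_connected_through_def joined_through_def by (meson subsetD)

lemma hamiltonian_connected_if_ham_connected_through:
  "ham_connected_through (edges G) (verts G) \<F> \<Longrightarrow> hamiltonian_connected G"
  unfolding ham_connected_through_def joined_through_def hamiltonian_connected_def
  by (cases G) (simp, meson)

locale laceable_attachment =
  fixes E :: "'a set set" and V :: "'a set" and h f :: "'k \<Rightarrow> 'a" and K :: "'k set"
    and c :: "'k \<Rightarrow> bool" and F :: "'a set set" and \<F> :: "'a set set set"
  assumes old: "ham_connected_through E V (insert (bicoloured h K c) \<F>)"
    and new: "laceable E f K c"
    and disjoint: "V \<inter> f ` K = {}"
    and inj_h: "inj_on h K" and h_image: "h ` K \<subseteq> V"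
    and rungs: "x \<in> K \<Longrightarrow> {h x, f x} \<in> E"
    and two_of_each_colour: "\<exists>x \<in> K. \<exists>y \<in> K. x \<noteq> y \<and> c x = b \<and> c y = b"
    and bicoloured_subset: "bicoloured h K c \<subseteq> F" "bicoloured f K c \<subseteq> F"
    and bicoloured_disjoint: "G \<in> \<F> \<Longrightarrow> bicoloured h K c \<inter> G = {}"
begin

lemma joined_if_superpath:
  assumes r: "hpath E (V \<union> f ` K) u v r" and p: "path_edges p \<subseteq> path_edges r"
    "\<forall>G \<in> insert (bicoloured h K c) \<F>. path_edges p \<inter> G \<noteq> {}"
  shows "joined_through E (V \<union> f ` K) (insert F \<F>) u v"
  using r p(2) unfolding ball_simps
  by (intro joined_throughI[OF r]) (use p(1) bicoloured_subset(1) in blast)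

lemma joined_old_old:
  assumes uv: "u \<in> V" "v \<in> V" "u \<noteq> v"
  shows "joined_through E (V \<union> f ` K) (insert F \<F>) u v"
proof -
  obtain p where p: "hpath E V u v p"
    "\<forall>G \<in> insert (bicoloured h K c) \<F>. path_edges p \<inter> G \<noteq> {}"
    using ham_connected_through_path[OF old uv] .
  then have "path_edges p \<inter> bicoloured h K c \<noteq> {}" by blast
  then obtain x y where xy: "{h x, h y} \<in> path_edges p" "x \<in> K" "y \<in> K" "c x \<noteq> c y"
    by (rule bicolouredE)
  obtain q where q: "hpath E (f ` K) (f x) (f y) q" "path_edges q \<subseteq> bicoloured f K c"
    "path_edges q \<noteq> {}" using laceable_path[OF new xy(2-4)] .
  obtain r where r: "hpath E (V \<union> f ` K) u v r"
    "path_edges p - {{h x, h y}} \<union> path_edges q \<subseteq> path_edges r"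
    using hpath_detour[OF p(1) xy(1) q(1) rungs[OF xy(2)] rungs[OF xy(3)] disjoint] .
  show ?thesis
  proof (rule joined_throughI[OF r(1)])
    fix G assume "G \<in> insert F \<F>"
    then show "path_edges r \<inter> G \<noteq> {}"
    proof
      assume "G = F"
      then show ?thesis using q(2,3) r(2) bicoloured_subset(2) by blast
    next
      assume G: "G \<in> \<F>"
      have "{h x, h y} \<in> bicoloured h K c" using xy(2-4) unfolding bicoloured_def by blast
      then have "{h x, h y} \<notin> G" using bicoloured_disjoint[OF G] by blast
      moreover have "path_edges p \<inter> G \<noteq> {}" using p(2) G by blast
      ultimately show ?thesis using r(2) by blast
    qed
  qed
qed

lemma joined_old_new:
  assumes u: "u \<in> V" and y: "y \<in> K"
  shows "joined_through E (V \<union> f ` K) (insert F \<F>) u (f y)"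
proof -
  obtain z z' where z: "z \<in> K" "z' \<in> K" "z \<noteq> z'" "c z \<noteq> c y" "c z' \<noteq> c y"
    using two_of_each_colour[of "\<not> c y"] by blast
  then have "h z \<noteq> h z'" using inj_h by (auto dest: inj_onD)
  then obtain x where x: "x \<in> K" "c x \<noteq> c y" "u \<noteq> h x" using z by blast
  have "h x \<in> V" using x(1) h_image by blast
  obtain p where p: "hpath E V u (h x) p"
    "\<forall>G \<in> insert (bicoloured h K c) \<F>. path_edges p \<inter> G \<noteq> {}"
    using ham_connected_through_path[OF old u \<open>h x \<in> V\<close> x(3)] .
  obtain q where q: "hpath E (f ` K) (f x) (f y) q" using laceable_path[OF new x(1) y x(2)] .
  note pq = hpath_append[OF p(1) q disjoint rungs[OF x(1)]]
  show ?thesis using joined_if_superpath[OF pq(1) _ p(2)] pq(2) by simp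
qed

text \<open>Cut a Hamiltonian path of the new part starting at \<open>f x\<close> just before \<open>f y\<close>, and join the two
  loose ends through \<open>V\<close>; the colours of \<open>x\<close> and \<open>y\<close> do not matter.\<close>

lemma joined_new_new:
  assumes xy: "x \<in> K" "y \<in> K" "f x \<noteq> f y"
  shows "joined_through E (V \<union> f ` K) (insert F \<F>) (f x) (f y)"
proof -
  obtain z where z: "z \<in> K" "c x \<noteq> c z" using two_of_each_colour[of "\<not> c x"] by blast
  obtain q where q: "hpath E (f ` K) (f x) (f z) q" using laceable_path[OF new xy(1) z] .
  obtain V1 V2 y' q1 q2 where cut: "hpath E V1 (f x) y' q1" "hpath E V2 (f y) (f z) q2"
    "f ` K = V1 \<union> V2" "V1 \<inter> V2 = {}"
    using hpath_split[OF q imageI[OF xy(2)] xy(3)[symmetric]] .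
  have ends: "y' \<in> V1" "f z \<in> V2" using hpath_ends[OF cut(1)] hpath_ends[OF cut(2)] by simp_all
  then obtain w where w: "y' = f w" "w \<in> K" using cut(3) by blast
  have "w \<noteq> z" using w ends cut(4) by blast
  then have "h w \<noteq> h z" using w z inj_h by (meson inj_onD)
  moreover have hV: "h w \<in> V" "h z \<in> V" using w(2) z(1) h_image by blast+
  ultimately obtain p where p: "hpath E V (h w) (h z) p"
    "\<forall>G \<in> insert (bicoloured h K c) \<F>. path_edges p \<inter> G \<noteq> {}"
    using ham_connected_through_path[OF old hV] by blast
  have disj: "V \<inter> V2 = {}" "V1 \<inter> (V \<union> V2) = {}" using disjoint cut(3,4) by blast+
  note pq = hpath_append[OF p(1) hpath_rev[OF cut(2)] disj(1) rungs[OF z(1)]]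
  have "{y', h w} \<in> E" using rungs[OF w(2)] w(1) by (simp add: insert_commute)
  note qpq = hpath_append[OF cut(1) pq(1) disj(2) this]
  have "V1 \<union> (V \<union> V2) = V \<union> f ` K" using cut(3) by blast
  then have "hpath E (V \<union> f ` K) (f x) (f y) (q1 @ p @ rev q2)" using qpq(1) by simp
  moreover have "path_edges p \<subseteq> path_edges (q1 @ p @ rev q2)" using qpq(2) pq(2) by blast
  ultimately show ?thesis using p(2) by (rule joined_if_superpath)
qed

lemma ham_connected_attachment: "ham_connected_through E (V \<union> f ` K) (insert F \<F>)"
  by (rule ham_connected_through_UnI) (auto intro: joined_old_old joined_old_new joined_new_new)

end

lemma joined_Un_same_part:
  assumes V: "ham_connected_through E V {bicoloured h K c}" and W: "ham_connected_through E W {}"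
    and disj: "V \<inter> W = {}" and f: "inj_on f K" "f ` K \<subseteq> W"
    and rungs: "\<And>x. x \<in> K \<Longrightarrow> {h x, f x} \<in> E"
    and uv: "u \<in> V" "v \<in> V" "u \<noteq> v"
  shows "joined_through E (V \<union> W) {} u v"
proof -
  obtain p where p: "hpath E V u v p" "\<forall>F \<in> {bicoloured h K c}. path_edges p \<inter> F \<noteq> {}"
    using ham_connected_through_path[OF V uv] .
  obtain x y where xy: "{h x, h y} \<in> path_edges p" "x \<in> K" "y \<in> K" "c x \<noteq> c y"
    using bicolouredE[OF p(2)[simplified]] .
  then have "x \<noteq> y" by blast
  then have "f x \<noteq> f y" "f x \<in> W" "f y \<in> W" using f xy by (auto dest: inj_onD)
  then obtain q where q: "hpath E W (f x) (f y) q" using ham_connected_through_path[OF W] by blast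
  obtain r where "hpath E (V \<union> W) u v r"
    using hpath_detour[OF p(1) xy(1) q rungs[OF xy(2)] rungs[OF xy(3)] disj] .
  then show ?thesis by (rule joined_throughI) simp
qed

lemma joined_Un_across:
  assumes V: "ham_connected_through E V \<F>" and W: "ham_connected_through E W {}"
    and disj: "V \<inter> W = {}" and h: "inj_on h K" "h ` K \<subseteq> V" and f: "inj_on f K" "f ` K \<subseteq> W"
    and rungs: "\<And>x. x \<in> K \<Longrightarrow> {h x, f x} \<in> E" and card: "3 \<le> card K"
    and uv: "u \<in> V" "v \<in> W"
  shows "joined_through E (V \<union> W) {} u v"
proof -
  obtain x y z where xyz: "x \<in> K" "y \<in> K" "z \<in> K" "x \<noteq> y" "x \<noteq> z" "y \<noteq> z"
    using card by (auto simp: numeral_3_eq_3 card_le_Suc_iff)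
  then have "h x \<noteq> h y" "h x \<noteq> h z" "h y \<noteq> h z" "f x \<noteq> f y" "f x \<noteq> f z" "f y \<noteq> f z"
    using h(1) f(1) by (auto dest: inj_onD)
  then obtain x where x: "x \<in> K" "u \<noteq> h x" "f x \<noteq> v" using xyz by metis
  have mem: "h x \<in> V" "f x \<in> W" using x(1) h(2) f(2) by blast+
  obtain p where p: "hpath E V u (h x) p"
    using ham_connected_through_path[OF V uv(1) mem(1) x(2)] .
  obtain q where q: "hpath E W (f x) v q"
    using ham_connected_through_path[OF W mem(2) uv(2) x(3)] .
  show ?thesis by (rule joined_throughI[OF hpath_append(1)[OF p q disj rungs[OF x(1)]]]) simp
qed

lemma joined_image:
  assumes "joined_through E V \<F> u v" "inj_on \<sigma> V" "\<And>e. e \<in> E \<Longrightarrow> \<sigma> ` e \<in> E"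
  shows "joined_through E (\<sigma> ` V) {} (\<sigma> u) (\<sigma> v)"
proof -
  obtain p where "hpath E V u v p" using assms(1) unfolding joined_through_def by blast
  from hpath_map[OF this assms(2,3)] show ?thesis by (rule joined_throughI) simp_all
qed

lemma ham_connected_Un_mirror:
  assumes V: "ham_connected_through E V {bicoloured h K c}"
    and involution: "\<And>x. x \<in> V \<Longrightarrow> \<sigma> (\<sigma> x) = x" and \<sigma>_edges: "\<And>e. e \<in> E \<Longrightarrow> \<sigma> ` e \<in> E"
    and disj: "V \<inter> \<sigma> ` V = {}"
    and h: "inj_on h K" "h ` K \<subseteq> V" and f: "inj_on f K" "f ` K \<subseteq> \<sigma> ` V"
    and rungs: "\<And>x. x \<in> K \<Longrightarrow> {h x, f x} \<in> E" and card: "3 \<le> card K"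
  shows "ham_connected_through E (V \<union> \<sigma> ` V) {}"
proof -
  have inj: "inj_on \<sigma> (V \<union> \<sigma> ` V)" using involution by (intro inj_on_inverseI[of _ \<sigma>]) auto
  have \<sigma>_\<sigma>: "\<sigma> ` \<sigma> ` V = V" using involution by (force simp: image_image)
  have W: "ham_connected_through E (\<sigma> ` V) {}"
    unfolding ham_connected_through_def
  proof (intro ballI impI)
    fix u v assume "u \<in> \<sigma> ` V" "v \<in> \<sigma> ` V" "u \<noteq> v"
    then obtain u' v' where uv': "u = \<sigma> u'" "v = \<sigma> v'" "u' \<in> V" "v' \<in> V" "u' \<noteq> v'" by blast
    have "joined_through E V {bicoloured h K c} u' v'"
      using V uv'(3-5) unfolding ham_connected_through_def by blast
    from joined_image[OF this inj_on_subset[OF inj] \<sigma>_edges]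
    show "joined_through E (\<sigma> ` V) {} u v" using uv'(1,2) by simp
  qed
  have same: "joined_through E (V \<union> \<sigma> ` V) {} u v" if "u \<in> V" "v \<in> V" "u \<noteq> v" for u v
    by (rule joined_Un_same_part[OF V W disj f rungs that])
  have across: "joined_through E (V \<union> \<sigma> ` V) {} u v" if "u \<in> V" "v \<in> \<sigma> ` V" for u v
    by (rule joined_Un_across[OF V W disj h f rungs card that])
  have mirrored: "joined_through E (V \<union> \<sigma> ` V) {} u v"
    if uv: "u \<in> \<sigma> ` V" "v \<in> \<sigma> ` V" "u \<noteq> v" for u v
  proof -
    obtain u' v' where uv': "u = \<sigma> u'" "v = \<sigma> v'" "u' \<in> V" "v' \<in> V" "u' \<noteq> v'"
      using uv by blast
    have "joined_through E (\<sigma> ` (V \<union> \<sigma> ` V)) {} (\<sigma> u') (\<sigma> v')"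
      using joined_image[OF same[OF uv'(3-5)] inj \<sigma>_edges] by simp
    then show ?thesis unfolding image_Un \<sigma>_\<sigma> uv'(1,2) by (simp add: Un_commute)
  qed
  show ?thesis by (rule ham_connected_through_UnI) (rule same across mirrored; assumption)+
qed

section \<open>Two cubes glued at a vertex\<close>

lemma ham_connected_through_two_squares:
  assumes distinct: "distinct [z, a, b, c, p, q, r]"
    and square: "{z, a} \<in> E \<inter> F" "{z, b} \<in> E \<inter> F" "{a, c} \<in> E \<inter> F" "{b, c} \<in> E \<inter> F"
    and square': "{z, p} \<in> E \<inter> F'" "{z, q} \<in> E \<inter> F'" "{p, r} \<in> E \<inter> F'" "{q, r} \<in> E \<inter> F'"
    and rungs: "{a, p} \<in> E" "{b, q} \<in> E" "{c, r} \<in> E"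
  shows "ham_connected_through E {z, a, b, c, p, q, r} {F, F'}"
proof -
  let ?V = "{z, a, b, c, p, q, r}"
  define admissible where "admissible xs \<longleftrightarrow> xs \<noteq> [] \<and> distinct xs \<and> set xs \<subseteq> ?V \<and> ?V \<subseteq> set xs
    \<and> path_edges xs \<subseteq> E \<and> (\<exists>e \<in> path_edges xs. e \<in> F) \<and> (\<exists>e \<in> path_edges xs. e \<in> F')" for xs
  have joined_if_admissible: "joined_through E ?V {F, F'} (hd xs) (last xs)"
    if "admissible xs" for xs
    using that unfolding admissible_def
    by (intro joined_throughI[where p = xs]) (unfold hpath_iff, blast+)
  have swap: "{y, x} \<in> H" if "{x, y} \<in> H" for x y :: 'a and H
    using that by (simp add: insert_commute)
  note edges = square[THEN IntD1] square'[THEN IntD1] square[THEN IntD2] square'[THEN IntD2] rungs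
  have "admissible [a, c, b, q, z, p, r]" "admissible [a, c, r, p, z, q, b]"
    "admissible [a, z, p, r, c, b, q]" "admissible [a, z, p, r, q, b, c]"
    "admissible [a, z, q, b, c, r, p]" "admissible [b, c, a, p, z, q, r]"
    "admissible [b, z, p, a, c, r, q]" "admissible [b, z, q, r, c, a, p]"
    "admissible [b, z, q, r, p, a, c]" "admissible [c, a, z, b, q, r, p]"
    "admissible [c, a, p, z, b, q, r]" "admissible [c, b, z, a, p, r, q]"
    "admissible [z, a, c, b, q, r, p]" "admissible [z, a, p, r, c, b, q]"
    "admissible [z, a, p, r, q, b, c]" "admissible [z, p, a, c, b, q, r]"
    "admissible [z, p, a, c, r, q, b]" "admissible [z, p, r, q, b, c, a]"
    "admissible [p, a, z, b, c, r, q]" "admissible [p, z, a, c, b, q, r]"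
    "admissible [q, z, b, c, a, p, r]"
    unfolding admissible_def by (simp_all add: edges edges[THEN swap]
        distinct[simplified] distinct[THEN distinct_rev[THEN iffD2], simplified])
  note joined = this[THEN joined_if_admissible, simplified]
  show ?thesis
    unfolding ham_connected_through_def by (simp add: joined joined[THEN joined_through_sym])
qed

locale glued_cubes =
  fixes E :: "'a set set" and g :: "bool \<Rightarrow> 'i set \<Rightarrow> 'a" and I :: "'i set" and a b :: 'i
  assumes finite_I: "finite I" and ab_subset: "{a, b} \<subseteq> I" and a_neq_b: "a \<noteq> b"
    and g_eq_iff: "\<lbrakk>S \<subseteq> I; T \<subseteq> I\<rbrakk> \<Longrightarrow> g s S = g t T \<longleftrightarrow> S = T \<and> (s = t \<or> S = {})"
    and cube_edges_subset: "cube_edges (g t) I \<subseteq> E"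
    and cross_edges: "S \<in> {{a}, {b}, {a, b}} \<Longrightarrow> {g False S, g True S} \<in> E"
begin

definition vertices :: "'i set \<Rightarrow> 'a set" where
  "vertices A = (\<Union>t. g t ` Pow A)"

definition cube_pairs :: "bool \<Rightarrow> 'i set \<Rightarrow> 'a set set" where
  "cube_pairs t A = bicoloured (g t) (Pow A) even_card"

lemma vertices_insert: "vertices (insert i A) = vertices A \<union> (\<Union>t. (g t \<circ> insert i) ` Pow A)"
  unfolding vertices_def image_Pow_insert by blast

lemma inj_on_g: "A \<subseteq> I \<Longrightarrow> inj_on (g t) (Pow A)"
  by (rule inj_on_subset[of _ "Pow I"]) (auto simp: inj_on_def g_eq_iff)

lemma cube_pairs_mono: "A \<subseteq> B \<Longrightarrow> cube_pairs t A \<subseteq> cube_pairs t B"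
  unfolding cube_pairs_def bicoloured_def by blast

lemma cube_pairs_insert:
  assumes "finite A" "i \<notin> A"
  shows "bicoloured (g t \<circ> insert i) (Pow A) even_card \<subseteq> cube_pairs t (insert i A)"
proof
  fix e assume "e \<in> bicoloured (g t \<circ> insert i) (Pow A) even_card"
  then obtain S T where e: "e = {g t (insert i S), g t (insert i T)}" "S \<subseteq> A" "T \<subseteq> A"
    "even_card S \<noteq> even_card T" by (auto simp: bicoloured_def)
  then have "even_card (insert i S) \<noteq> even_card (insert i T)"
    using assms even_card_insert finite_subset by (metis subsetD)
  moreover have "insert i S \<in> Pow (insert i A)" "insert i T \<in> Pow (insert i A)" using e by auto
  ultimately show "e \<in> cube_pairs t (insert i A)"
    unfolding cube_pairs_def bicoloured_def e(1) by blast
qed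

lemma cube_pairs_disjoint:
  assumes "A \<subseteq> I" "B \<subseteq> I" "s \<noteq> t"
  shows "cube_pairs s A \<inter> cube_pairs t B = {}"
proof (rule equals0I)
  fix e assume e: "e \<in> cube_pairs s A \<inter> cube_pairs t B"
  then obtain S S' where S: "e = {g s S, g s S'}" "S \<subseteq> A" "S' \<subseteq> A" "even_card S \<noteq> even_card S'"
    unfolding cube_pairs_def bicoloured_def by blast
  have "e \<subseteq> g t ` Pow B" using e unfolding cube_pairs_def bicoloured_def by auto
  have "S \<noteq> {} \<or> S' \<noteq> {}" using S(4) by blast
  moreover have "g s T \<notin> g t ` Pow B" if "T \<subseteq> A" "T \<noteq> {}" for T
  proof
    assume "g s T \<in> g t ` Pow B"
    then obtain U where "g s T = g t U" "U \<subseteq> I" using assms(2) by blast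
    moreover have "T \<subseteq> I" using that(1) assms(1) by blast
    ultimately show False using that(2) assms(3) by (simp add: g_eq_iff)
  qed
  ultimately show False using S(1-3) \<open>e \<subseteq> g t ` Pow B\<close> by blast
qed

lemma two_of_each_parity:
  assumes "{a, b} \<subseteq> A"
  shows "\<exists>S \<in> Pow A. \<exists>T \<in> Pow A. S \<noteq> T \<and> even_card S = p \<and> even_card T = p"
proof (cases p)
  case True
  then show ?thesis
    using assms a_neq_b by (intro bexI[of _ "{}"] bexI[of _ "{a, b}"]) (auto simp: even_card_def)
next
  case False
  then show ?thesis
    using assms a_neq_b by (intro bexI[of _ "{a}"] bexI[of _ "{b}"]) (auto simp: even_card_def)
qed

lemma ham_connected_attach_cube:
  assumes A: "insert i A \<subseteq> I" "i \<notin> A" "{a, b} \<subseteq> A"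
    and V: "ham_connected_through E V {cube_pairs t A, F}" "vertices A \<subseteq> V"
    and disj: "V \<inter> (g t \<circ> insert i) ` Pow A = {}" "cube_pairs t A \<inter> F = {}"
  shows "ham_connected_through E (V \<union> (g t \<circ> insert i) ` Pow A) {cube_pairs t (insert i A), F}"
proof -
  have fin: "finite A" using A(1) finite_I finite_subset by auto
  have edges: "cube_edges (g t) (insert i A) \<subseteq> E"
    using cube_edges_mono[OF A(1)] cube_edges_subset by blast
  interpret laceable_attachment E V "g t" "g t \<circ> insert i" "Pow A" even_card
    "cube_pairs t (insert i A)" "{F}"
  proof
    show "ham_connected_through E V (insert (bicoloured (g t) (Pow A) even_card) {F})"
      using V(1) unfolding cube_pairs_def .
    show "laceable E (g t \<circ> insert i) (Pow A) even_card"
      using laceable_cube[OF fin inj_on_Pow_insert(2)[OF inj_on_g[OF A(1)] A(2)]]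
        cube_edges_insert[OF A(2), of "g t"] edges by (meson subset_trans)
    show "inj_on (g t) (Pow A)" using A(1) by (intro inj_on_g) blast
    show "g t ` Pow A \<subseteq> V" using V(2) unfolding vertices_def by blast
    show "{g t S, (g t \<circ> insert i) S} \<in> E" if "S \<in> Pow A" for S
      using cube_edgesI[of S "insert i A" i "g t"] that A(2) edges by auto
    show "\<exists>S \<in> Pow A. \<exists>T \<in> Pow A. S \<noteq> T \<and> even_card S = p \<and> even_card T = p" for p
      using two_of_each_parity[OF A(3)] .
    show "bicoloured (g t) (Pow A) even_card \<subseteq> cube_pairs t (insert i A)"
      unfolding cube_pairs_def[symmetric] by (rule cube_pairs_mono) blast
    show "bicoloured (g t \<circ> insert i) (Pow A) even_card \<subseteq> cube_pairs t (insert i A)"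
      by (rule cube_pairs_insert[OF fin A(2)])
    show "bicoloured (g t) (Pow A) even_card \<inter> G = {}" if "G \<in> {F}" for G
      using disj(2) that unfolding cube_pairs_def by simp
  qed (rule disj(1))
  show ?thesis by (rule ham_connected_attachment)
qed

lemma new_cubes_disjoint:
  assumes "insert i A \<subseteq> I" "i \<notin> A"
  shows "vertices A \<inter> (g t \<circ> insert i) ` Pow A = {}"
    and "s \<noteq> t \<Longrightarrow> (g s \<circ> insert i) ` Pow A \<inter> (g t \<circ> insert i) ` Pow A = {}"
proof -
  have g_neq: "g s S \<noteq> g t (insert i T)" if "S \<subseteq> insert i A" "T \<subseteq> A" "i \<notin> S \<or> s \<noteq> t" for s S T
  proof -
    have "S \<subseteq> I" "insert i T \<subseteq> I" using that assms(1) by blast+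
    then show ?thesis using that(3) by (auto simp: g_eq_iff)
  qed
  show "vertices A \<inter> (g t \<circ> insert i) ` Pow A = {}"
  proof (rule equals0I)
    fix x assume "x \<in> vertices A \<inter> (g t \<circ> insert i) ` Pow A"
    then obtain s S T where "x = g s S" "x = g t (insert i T)" "S \<subseteq> A" "T \<subseteq> A"
      unfolding vertices_def by auto
    then show False using g_neq[of S T s] assms(2) by blast
  qed
  show "(g s \<circ> insert i) ` Pow A \<inter> (g t \<circ> insert i) ` Pow A = {}" if "s \<noteq> t"
  proof (rule equals0I)
    fix x assume "x \<in> (g s \<circ> insert i) ` Pow A \<inter> (g t \<circ> insert i) ` Pow A"
    then obtain S T where "x = g s (insert i S)" "x = g t (insert i T)" "S \<subseteq> A" "T \<subseteq> A"
      unfolding comp_def by blast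
    then show False using g_neq[of "insert i S" T s] that by blast
  qed
qed

lemma ham_connected_vertices_insert:
  assumes A: "insert i A \<subseteq> I" "i \<notin> A" "{a, b} \<subseteq> A"
    and IH: "ham_connected_through E (vertices A) {cube_pairs False A, cube_pairs True A}"
  shows "ham_connected_through E (vertices (insert i A))
    {cube_pairs False (insert i A), cube_pairs True (insert i A)}"
proof -
  let ?X = "\<lambda>t. (g t \<circ> insert i) ` Pow A"
  note disj = new_cubes_disjoint[OF A(1,2)]
  have sub: "A \<subseteq> I" using A(1) by blast
  have "ham_connected_through E (vertices A \<union> ?X False)
      {cube_pairs False (insert i A), cube_pairs True A}"
    using cube_pairs_disjoint[OF sub sub, of False True]
    by (intro ham_connected_attach_cube[OF A IH order_refl disj(1)]) simp
  then have "ham_connected_through E (vertices A \<union> ?X False)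
      {cube_pairs True A, cube_pairs False (insert i A)}" by (simp add: insert_commute)
  moreover have "(vertices A \<union> ?X False) \<inter> ?X True = {}"
    using disj(1)[of True] disj(2)[of False True] by blast
  ultimately have "ham_connected_through E (vertices A \<union> ?X False \<union> ?X True)
      {cube_pairs True (insert i A), cube_pairs False (insert i A)}"
    by (rule ham_connected_attach_cube[OF A _ Un_upper1 _ cube_pairs_disjoint[OF sub A(1)]]) simp
  then show ?thesis
    by (simp add: vertices_insert UNIV_bool insert_commute Un_assoc Un_commute[of "?X True"])
qed

lemma ham_connected_vertices_pair:
  "ham_connected_through E (vertices {a, b}) {cube_pairs False {a, b}, cube_pairs True {a, b}}"
proof -
  define z where "z = g False {}"
  have subs: "{} \<subseteq> I" "{a} \<subseteq> I" "{b} \<subseteq> I" "{a, b} \<subseteq> I" using ab_subset by simp_all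
  have z: "g t {} = z" for t unfolding z_def using subs by (simp add: g_eq_iff)
  have edge: "{g t S, g t (insert i S)} \<in> E \<inter> cube_pairs t {a, b}"
    if "S \<subseteq> {a, b}" "i \<in> {a, b} - S" for t i S
    using cube_edgesI[OF that] cube_edges_mono[OF subs(4)] cube_edges_subset
      cube_edges_bicoloured[of "{a, b}" "g t"] unfolding cube_pairs_def by blast
  have square: "{z, g t {a}} \<in> E \<inter> cube_pairs t {a, b}" "{z, g t {b}} \<in> E \<inter> cube_pairs t {a, b}"
    "{g t {a}, g t {a, b}} \<in> E \<inter> cube_pairs t {a, b}"
    "{g t {b}, g t {a, b}} \<in> E \<inter> cube_pairs t {a, b}" for t
    using edge[of "{}" a t] edge[of "{}" b t] edge[of "{a}" b t] edge[of "{b}" a t] a_neq_b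
    by (simp_all add: z insert_commute)
  have "distinct [z, g False {a}, g False {b}, g False {a, b}, g True {a}, g True {b},
      g True {a, b}]"
    unfolding z_def using subs a_neq_b by (auto simp: g_eq_iff)
  from ham_connected_through_two_squares[OF this square square]
  have "ham_connected_through E
      {z, g False {a}, g False {b}, g False {a, b}, g True {a}, g True {b}, g True {a, b}}
      {cube_pairs False {a, b}, cube_pairs True {a, b}}"
    using cross_edges by blast
  moreover have "vertices {a, b} = {z, g False {a}, g False {b}, g False {a, b}, g True {a},
    g True {b}, g True {a, b}}"
    by (auto simp: vertices_def Pow_insert UNIV_bool z)
  ultimately show ?thesis by simp
qed

lemma ham_connected_vertices:
  assumes "{a, b} \<subseteq> A" "A \<subseteq> I"
  shows "ham_connected_through E (vertices A) {cube_pairs False A, cube_pairs True A}"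
proof -
  have "ham_connected_through E (vertices (B \<union> {a, b}))
      {cube_pairs False (B \<union> {a, b}), cube_pairs True (B \<union> {a, b})}" if "finite B" "B \<subseteq> I" for B
    using that
  proof (induction B rule: finite_induct)
    case empty
    show ?case using ham_connected_vertices_pair by simp
  next
    case (insert i B)
    show ?case
    proof (cases "i \<in> B \<union> {a, b}")
      case True
      then have "insert i B \<union> {a, b} = B \<union> {a, b}" by blast
      then show ?thesis using insert.IH insert.prems by simp
    next
      case False
      then show ?thesis
        unfolding Un_insert_left using insert.IH insert.prems ab_subset
        by (intro ham_connected_vertices_insert) auto
    qed
  qed
  moreover have "A \<union> {a, b} = A" "finite A" using assms finite_subset[OF _ finite_I] by blast+
  ultimately show ?thesis using assms(2) by metis
qed

end

section \<open>Trees given by a parent function\<close>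

definition adjacency :: "'v sgraph \<Rightarrow> 'v rel" where
  "adjacency G = {(x, y). x \<in> verts G \<and> y \<in> verts G \<and> {x, y} \<in> edges G}"

lemma ex_path_between_if_rtrancl:
  assumes "(u, v) \<in> (adjacency G)\<^sup>*" "u \<in> verts G"
  shows "\<exists>p. path_between G u v p"
  using assms
proof (induction rule: rtrancl_induct)
  case base
  then have "path_between G u u [u]" by (simp add: path_between_def is_path_def)
  then show ?case ..
next
  case (step y z)
  then obtain p where p: "path_between G u y p" by blast
  show ?case
  proof (cases "z \<in> set p")
    case True
    then obtain xs ys where "p = xs @ z # ys" by (meson split_list)
    then have "path_between G u z (xs @ [z])"
      using p by (auto simp: path_between_def is_path_def successively_append_iff hd_append)
    then show ?thesis ..
  next
    case False
    then have "path_between G u z (p @ [z])" using p step.hyps(2)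
      by (auto simp: path_between_def is_path_def successively_append_iff adjacency_def)
    then show ?thesis ..
  qed
qed

lemma cycle_vertex_two_neighbours:
  assumes "is_cycle G p" "v \<in> set p"
  obtains x y where "x \<in> set p" "y \<in> set p" "x \<noteq> y" "{v, x} \<in> edges G" "{v, y} \<in> edges G"
proof -
  obtain xs ys where p: "p = xs @ v # ys" using assms(2) by (meson split_list)
  let ?q = "ys @ xs"
  have path: "distinct p" "successively (\<lambda>x y. {x, y} \<in> edges G) p" "{last p, hd p} \<in> edges G"
    "3 \<le> length p" using assms(1) by (auto simp: is_cycle_def is_path_def)
  have succ: "{v, hd ?q} \<in> edges G"
    using path(2,3,4) p
    by (cases ys) (auto simp: successively_append_iff hd_append split: if_splits)
  have pred: "{v, last ?q} \<in> edges G"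
    using path(2,3,4) p
    by (cases xs rule: rev_cases)
      (auto simp: successively_append_iff insert_commute split: if_splits)
  have "2 \<le> length ?q" "distinct ?q" using path(1,4) p by auto
  then have "hd ?q \<noteq> last ?q" by (cases ?q) (auto simp del: append_is_Nil_conv)
  moreover have "?q \<noteq> []" "set ?q \<subseteq> set p" using \<open>2 \<le> length ?q\<close> p by auto
  then have "hd ?q \<in> set p" "last ?q \<in> set p" using hd_in_set[of ?q] last_in_set[of ?q] by blast+
  ultimately show thesis using that succ pred by blast
qed

locale parent_function =
  fixes V :: "'v set" and r :: 'v and par :: "'v \<Rightarrow> 'v"
  assumes root: "r \<in> V"
    and par_closed: "v \<in> V \<Longrightarrow> par v \<in> V"
    and reaches_root: "v \<in> V \<Longrightarrow> \<exists>k. (par ^^ k) v = r"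
begin

definition graph :: "'v sgraph" where
  "graph = \<lparr>verts = V, edges = {{v, par v} | v. v \<in> V \<and> v \<noteq> r}\<rparr>"

definition height :: "'v \<Rightarrow> nat" where
  "height v = (LEAST k. (par ^^ k) v = r)"

lemma height_par_less:
  assumes "v \<in> V" "v \<noteq> r"
  shows "height (par v) < height v"
proof -
  have "(par ^^ height v) v = r"
    unfolding height_def using reaches_root[OF assms(1)] by (rule LeastI_ex)
  moreover from this obtain k where k: "height v = Suc k" using assms(2) by (cases "height v") auto
  ultimately have "(par ^^ k) (par v) = r" by (simp add: funpow_swap1)
  then have "height (par v) \<le> k" unfolding height_def by (rule Least_le)
  then show ?thesis using k by simp
qed

lemma adjacency_rtrancl_root:
  assumes "v \<in> V"
  shows "(v, r) \<in> (adjacency graph)\<^sup>*"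
  using assms
proof (induction "height v" arbitrary: v rule: less_induct)
  case less
  show ?case
  proof (cases "v = r")
    case False
    then have "(v, par v) \<in> adjacency graph"
      using less.prems par_closed by (auto simp: adjacency_def graph_def)
    moreover have "(par v, r) \<in> (adjacency graph)\<^sup>*"
      using less height_par_less par_closed False by blast
    ultimately show ?thesis by (rule converse_rtrancl_into_rtrancl)
  qed simp
qed

lemma graph_connected:
  assumes "u \<in> V" "v \<in> V"
  shows "\<exists>p. path_between graph u v p"
proof -
  have "sym (adjacency graph)" by (auto simp: sym_def adjacency_def insert_commute)
  then have "(r, v) \<in> (adjacency graph)\<^sup>*"
    using adjacency_rtrancl_root[OF assms(2)] sym_rtrancl by (meson symD)
  then have "(u, v) \<in> (adjacency graph)\<^sup>*"
    using adjacency_rtrancl_root[OF assms(1)] by (rule rtrancl_trans[rotated])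
  then show ?thesis by (rule ex_path_between_if_rtrancl) (simp add: graph_def assms(1))
qed

lemma lower_neighbour_is_par:
  assumes "{v, w} \<in> edges graph" "height w \<le> height v"
  shows "w = par v"
proof -
  obtain x where x: "{v, w} = {x, par x}" "x \<in> V" "x \<noteq> r" using assms(1) by (auto simp: graph_def)
  then show ?thesis using height_par_less[OF x(2,3)] assms(2) by (auto simp: doubleton_eq_iff)
qed

text \<open>Both neighbours on a cycle of a vertex of maximal height would have to be its parent.\<close>

lemma graph_acyclic: "\<not> is_cycle graph p"
proof
  assume p: "is_cycle graph p"
  then have "p \<noteq> []" by (auto simp: is_cycle_def is_path_def)
  then have "Max (height ` set p) \<in> height ` set p" by (intro Max_in) auto
  then obtain v where v: "v \<in> set p" "height v = Max (height ` set p)" by auto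
  then have max: "height w \<le> height v" if "w \<in> set p" for w using that by simp
  obtain x y where "x \<in> set p" "y \<in> set p" "x \<noteq> y" "{v, x} \<in> edges graph" "{v, y} \<in> edges graph"
    using cycle_vertex_two_neighbours[OF p v(1)] .
  then show False using lower_neighbour_is_par max by metis
qed

lemma is_tree_graph: "is_tree graph"
  using root graph_connected graph_acyclic unfolding is_tree_def by (auto simp: graph_def)

end

section \<open>Sets of wheel edges\<close>

definition spoke :: "nat \<Rightarrow> wheel_vertex set" where
  "spoke i = {Hub, Rim i}"

definition rim :: "nat \<Rightarrow> nat \<Rightarrow> wheel_vertex set" where
  "rim n i = {Rim i, Rim (Suc i mod n)}"

definition wheel_edges :: "nat \<Rightarrow> nat set \<Rightarrow> nat set \<Rightarrow> wheel_vertex set set" where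
  "wheel_edges n S R = case_sum spoke (rim n) ` (S <+> R)"

lemma wheel_edges_eq: "wheel_edges n S R = spoke ` S \<union> rim n ` R"
  by (simp add: wheel_edges_def Plus_def image_Un image_image)

lemma edges_wheel: "edges (wheel n) = wheel_edges n {..<n} {..<n}"
  by (auto simp: wheel_def rim_edges_def spokes_def wheel_edges_eq spoke_def rim_def)

lemma spoke_neq_rim: "spoke i \<noteq> rim n j"
  by (auto simp: spoke_def rim_def doubleton_eq_iff)

lemma inj_on_wheel_edge:
  assumes "3 \<le> n"
  shows "inj_on (case_sum spoke (rim n)) ({..<n} <+> {..<n})"
proof -
  have "inj spoke" by (auto simp: inj_def spoke_def doubleton_eq_iff)
  moreover have "inj_on (rim n) {..<n}"
    using assms by (auto simp: inj_on_def rim_def doubleton_eq_iff mod_Suc split: if_splits)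
  ultimately show ?thesis
    using spoke_neq_rim spoke_neq_rim[symmetric] by (auto simp: inj_on_def)
qed

lemma spoke_in_wheel_edges: "spoke i \<in> wheel_edges n S R \<longleftrightarrow> i \<in> S"
  using spoke_neq_rim by (auto simp: wheel_edges_eq) (auto simp: spoke_def doubleton_eq_iff)

lemma wheel_edges_eq_iff:
  assumes "3 \<le> n" "S \<subseteq> {..<n}" "R \<subseteq> {..<n}" "S' \<subseteq> {..<n}" "R' \<subseteq> {..<n}"
  shows "wheel_edges n S R = wheel_edges n S' R' \<longleftrightarrow> S = S' \<and> R = R'"
proof -
  have "S <+> R = S' <+> R' \<longleftrightarrow> S = S' \<and> R = R'" by (auto simp: Plus_def)
  then show ?thesis
    unfolding wheel_edges_def using assms
    by (subst inj_on_image_eq_iff[OF inj_on_wheel_edge]) auto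
qed

lemma wheel_edges_diff:
  assumes "3 \<le> n" "S \<subseteq> {..<n}" "R \<subseteq> {..<n}" "S' \<subseteq> {..<n}" "R' \<subseteq> {..<n}"
  shows "wheel_edges n S R - wheel_edges n S' R' = wheel_edges n (S - S') (R - R')"
proof -
  have "(S <+> R) - (S' <+> R') = (S - S') <+> (R - R')" by auto
  then show ?thesis
    unfolding wheel_edges_def using assms
    by (subst inj_on_image_set_diff[OF inj_on_wheel_edge, symmetric]) auto
qed

lemma card_wheel_edges:
  assumes "3 \<le> n" "S \<subseteq> {..<n}" "R \<subseteq> {..<n}"
  shows "card (wheel_edges n S R) = card S + card R"
proof -
  have "inj_on (case_sum spoke (rim n)) (S <+> R)"
    by (rule inj_on_subset[OF inj_on_wheel_edge[OF assms(1)]]) (use assms in auto)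
  then show ?thesis
    unfolding wheel_edges_def using assms
    by (simp add: card_image card_Plus finite_subset[OF _ finite_lessThan])
qed

lemma card_sym_diff_wheel_edges:
  assumes "3 \<le> n" "S \<subseteq> {..<n}" "R \<subseteq> {..<n}" "S' \<subseteq> {..<n}" "R' \<subseteq> {..<n}"
  shows "card (sym_diff (wheel_edges n S R) (wheel_edges n S' R'))
    = card (sym_diff S S') + card (sym_diff R R')"
proof -
  have "wheel_edges n A B \<union> wheel_edges n C D = wheel_edges n (A \<union> C) (B \<union> D)" for A B C D
    by (auto simp: wheel_edges_eq)
  then show ?thesis using assms by (simp add: wheel_edges_diff) (subst card_wheel_edges; auto)
qed

lemma wheel_edges_exhaust:
  assumes "B \<subseteq> edges (wheel n)"
  shows "B = wheel_edges n {i \<in> {..<n}. spoke i \<in> B} {i \<in> {..<n}. rim n i \<in> B}"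
  using assms unfolding edges_wheel wheel_edges_eq by auto

section \<open>Bases of the whirl from orientations of the rim\<close>

text \<open>Besides the spokes \<open>S\<close>, every rim vertex outside \<open>S\<close> contributes the rim edge to its
  successor (\<open>t = False\<close>) or to its predecessor (\<open>t = True\<close>); \<open>rim_end n t i\<close> is the vertex that
  would contribute \<open>rim n i\<close>.\<close>

definition rim_end :: "nat \<Rightarrow> bool \<Rightarrow> nat \<Rightarrow> nat" where
  "rim_end n t i = (if t then Suc i mod n else i)"

definition rim_step :: "nat \<Rightarrow> bool \<Rightarrow> nat \<Rightarrow> nat" where
  "rim_step n t i = (if t then (i + (n - 1)) mod n else Suc i mod n)"

definition uncovered :: "nat \<Rightarrow> bool \<Rightarrow> nat set \<Rightarrow> nat set" where
  "uncovered n t S = {i \<in> {..<n}. rim_end n t i \<notin> S}"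

definition whirl_base :: "nat \<Rightarrow> bool \<Rightarrow> nat set \<Rightarrow> wheel_vertex set set" where
  "whirl_base n t S = wheel_edges n S (uncovered n t S)"

lemma rim_end_less: "i < n \<Longrightarrow> rim_end n t i < n"
  by (simp add: rim_end_def)

lemma rim_step_less: "i < n \<Longrightarrow> rim_step n t i < n"
  by (simp add: rim_step_def)

lemma rim_step_True_Suc_mod:
  assumes "0 < n"
  shows "rim_step n True (Suc k mod n) = k mod n"
proof -
  have "Suc k + (n - 1) = k + n" using assms by simp
  then show ?thesis unfolding rim_step_def by (simp only: mod_add_left_eq if_True) simp
qed

lemma rim_step_rim_end: "i < n \<Longrightarrow> rim_step n t (rim_end n t i) = rim_end n (\<not> t) i"
  using rim_step_True_Suc_mod[of n i] by (auto simp: rim_end_def rim_step_def)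

lemma rim_eq_rim_ends: "rim n i = {Rim (rim_end n t i), Rim (rim_end n (\<not> t) i)}"
  by (auto simp: rim_def rim_end_def)

lemma bij_betw_rim_end: "bij_betw (rim_end n t) {..<n} {..<n}"
proof -
  have "inj_on (rim_end n t) {..<n}"
    by (auto simp: inj_on_def rim_end_def mod_Suc split: if_splits)
  moreover have "rim_end n t ` {..<n} \<subseteq> {..<n}" using rim_end_less by auto
  ultimately show ?thesis
    unfolding bij_betw_def by (simp add: endo_inj_surj)
qed

lemma ex_rim_step_funpow:
  assumes "i < n" "j < n"
  shows "\<exists>k. (rim_step n t ^^ k) i = j"
proof (cases t)
  case True
  have "(rim_step n True ^^ k) ((j + k) mod n) = j" for k
  proof (induction k)
    case (Suc k)
    have "rim_step n True ((j + Suc k) mod n) = (j + k) mod n"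
      using assms rim_step_True_Suc_mod[of n "j + k"] by simp
    then show ?case using Suc by (simp add: funpow_swap1)
  qed (use assms in simp)
  from this[of "n + i - j"] show ?thesis using assms True by auto
next
  case False
  have "(rim_step n False ^^ k) i = (i + k) mod n" for k
    using assms by (induction k) (simp_all add: rim_step_def mod_Suc_eq)
  from this[of "n + j - i"] show ?thesis using assms False by auto
qed

lemma rim_end_image_uncovered: "rim_end n t ` uncovered n t S = {..<n} - S"
proof -
  have "rim_end n t ` {..<n} = {..<n}" by (rule bij_betw_imp_surj_on[OF bij_betw_rim_end])
  then show ?thesis by (auto simp: uncovered_def)
qed

lemma uncovered_subset: "uncovered n t S \<subseteq> {..<n}"
  by (auto simp: uncovered_def)

lemma whirl_base_subset: "S \<subseteq> {..<n} \<Longrightarrow> whirl_base n t S \<subseteq> edges (wheel n)"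
  using uncovered_subset unfolding whirl_base_def edges_wheel wheel_edges_eq by blast

lemma whirl_base_complement:
  assumes "3 \<le> n" "S \<subseteq> {..<n}"
  shows "edges (wheel n) - whirl_base n t S = whirl_base n t ({..<n} - S)"
proof -
  have "{..<n} - uncovered n t S = uncovered n t ({..<n} - S)"
    using rim_end_less by (auto simp: uncovered_def)
  then show ?thesis
    unfolding whirl_base_def edges_wheel using assms
    by (subst wheel_edges_diff) (simp_all add: uncovered_subset)
qed

definition whirl_parent :: "nat \<Rightarrow> bool \<Rightarrow> nat set \<Rightarrow> wheel_vertex \<Rightarrow> wheel_vertex" where
  "whirl_parent n t S v =
     (case v of Hub \<Rightarrow> Hub | Rim i \<Rightarrow> if i \<in> S then Hub else Rim (rim_step n t i))"

lemma whirl_base_eq_parent_edges: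
  assumes "S \<subseteq> {..<n}"
  shows "whirl_base n t S = {{v, whirl_parent n t S v} | v. v \<in> verts (wheel n) \<and> v \<noteq> Hub}"
proof -
  have "{{v, whirl_parent n t S v} | v. v \<in> verts (wheel n) \<and> v \<noteq> Hub}
      = (\<lambda>i. {Rim i, whirl_parent n t S (Rim i)}) ` {..<n}"
    by (auto simp: wheel_def)
  also have "\<dots> = (\<lambda>i. {Rim i, whirl_parent n t S (Rim i)}) ` (S \<union> ({..<n} - S))"
    using assms by (simp add: Un_absorb1)
  also have "\<dots> = spoke ` S \<union> (\<lambda>i. {Rim i, Rim (rim_step n t i)}) ` ({..<n} - S)"
    unfolding image_Un by (intro arg_cong2[where f = "(\<union>)"] image_cong)
      (auto simp: whirl_parent_def spoke_def insert_commute)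
  also have "(\<lambda>i. {Rim i, Rim (rim_step n t i)}) ` ({..<n} - S) = rim n ` uncovered n t S"
    unfolding rim_end_image_uncovered[of n t, symmetric] image_image
    by (intro image_cong refl)
      (simp add: uncovered_def rim_step_rim_end rim_eq_rim_ends[of n _ t])
  finally show ?thesis by (simp add: whirl_base_def wheel_edges_eq)
qed

lemma whirl_parent_reaches_hub:
  assumes "(rim_step n t ^^ k) i \<in> S"
  shows "\<exists>m. (whirl_parent n t S ^^ m) (Rim i) = Hub"
  using assms
proof (induction k arbitrary: i)
  case 0
  then have "(whirl_parent n t S ^^ 1) (Rim i) = Hub" by (simp add: whirl_parent_def)
  then show ?case ..
next
  case (Suc k)
  show ?case
  proof (cases "i \<in> S")
    case True
    then have "(whirl_parent n t S ^^ 1) (Rim i) = Hub" by (simp add: whirl_parent_def)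
    then show ?thesis ..
  next
    case False
    obtain m where "(whirl_parent n t S ^^ m) (Rim (rim_step n t i)) = Hub"
      using Suc by (auto simp: funpow_swap1)
    then have "(whirl_parent n t S ^^ Suc m) (Rim i) = Hub"
      using False by (simp add: funpow_swap1 whirl_parent_def)
    then show ?thesis ..
  qed
qed

lemma whirl_base_spanning_tree:
  assumes S: "S \<subseteq> {..<n}" "S \<noteq> {}"
  shows "whirl_base n t S \<in> spanning_trees (wheel n)"
proof -
  interpret parent_function "verts (wheel n)" Hub "whirl_parent n t S"
  proof
    fix v assume v: "v \<in> verts (wheel n)"
    show "whirl_parent n t S v \<in> verts (wheel n)"
      using v by (auto simp: wheel_def whirl_parent_def rim_step_less split: if_splits)
    obtain j where j: "j \<in> S" "j < n" using S by blast
    show "\<exists>k. (whirl_parent n t S ^^ k) v = Hub"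
    proof (cases v)
      case Hub
      then have "(whirl_parent n t S ^^ 0) v = Hub" by simp
      then show ?thesis ..
    next
      case (Rim i)
      then have "i < n" using v by (auto simp: wheel_def)
      then obtain k where "(rim_step n t ^^ k) i \<in> S"
        using ex_rim_step_funpow[of i n j t] j by auto
      then show ?thesis unfolding Rim by (rule whirl_parent_reaches_hub)
    qed
  qed (simp add: wheel_def)
  show ?thesis
    using is_tree_graph whirl_base_subset[OF S(1), of t]
    unfolding graph_def spanning_trees_def whirl_base_eq_parent_edges[OF S(1)] by blast
qed

lemma whirl_base_in_bases:
  assumes "S \<subseteq> {..<n}"
  shows "whirl_base n t S \<in> bases (whirl n)"
proof (cases "S = {}")
  case True
  then have "whirl_base n t S = rim_edges n"
    by (auto simp: whirl_base_def uncovered_def wheel_edges_eq rim_edges_def rim_def)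
  then show ?thesis by (simp add: whirl_def)
next
  case False
  then show ?thesis using whirl_base_spanning_tree[OF assms] by (simp add: whirl_def)
qed

section \<open>Cycles excluded from base-cobases\<close>

lemma base_with_spoke_acyclic:
  assumes "B \<in> bases (whirl n)" "spoke i \<in> B"
  shows "\<not> is_cycle \<lparr>verts = verts (wheel n), edges = B\<rparr> p"
proof -
  have "B \<noteq> rim_edges n"
    using assms(2) by (auto simp: rim_edges_def spoke_def doubleton_eq_iff)
  then show ?thesis using assms(1) by (simp add: whirl_def spanning_trees_def is_tree_def)
qed

lemma bij_betw_mod_shift:
  fixes j n :: nat
  shows "bij_betw (\<lambda>k. (j + k) mod n) {..<n} {..<n}"
proof (induction j)
  case 0
  have "bij_betw (\<lambda>k. k) {..<n} {..<n}" by (rule bij_betwI') auto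
  then show ?case by (rule bij_betw_cong[THEN iffD1, rotated]) simp
next
  case (Suc j)
  have "bij_betw (rim_end n True \<circ> (\<lambda>k. (j + k) mod n)) {..<n} {..<n}"
    by (rule bij_betw_trans[OF Suc.IH bij_betw_rim_end])
  then show ?case by (simp add: comp_def rim_end_def mod_Suc_eq)
qed

definition rim_walk :: "nat \<Rightarrow> nat \<Rightarrow> nat \<Rightarrow> wheel_vertex list" where
  "rim_walk n j l = map (\<lambda>k. Rim ((j + k) mod n)) [0..<l]"

lemma rim_walk_is_path:
  assumes "1 \<le> l" "l \<le> n" and rims: "\<And>k. Suc k < l \<Longrightarrow> rim n ((j + k) mod n) \<in> B"
  shows "is_path \<lparr>verts = verts (wheel n), edges = B\<rparr> (rim_walk n j l)"
proof -
  have "inj_on (\<lambda>k. (j + k) mod n) {..<l}"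
    by (rule inj_on_subset[OF bij_betw_imp_inj_on[OF bij_betw_mod_shift]]) (use assms(2) in auto)
  then have "distinct (rim_walk n j l)"
    by (simp add: rim_walk_def distinct_map inj_on_def lessThan_atLeast0)
  moreover have "{rim_walk n j l ! k, rim_walk n j l ! Suc k} \<in> B" if "Suc k < l" for k
    using rims[OF that] that by (simp add: rim_walk_def rim_def mod_Suc_eq)
  then have "successively (\<lambda>x y. {x, y} \<in> B) (rim_walk n j l)"
    by (auto simp: successively_conv_nth rim_walk_def)
  moreover have "rim_walk n j l \<noteq> []" "set (rim_walk n j l) \<subseteq> verts (wheel n)"
    using assms(1,2) by (auto simp: rim_walk_def wheel_def)
  ultimately show ?thesis by (simp add: is_path_def)
qed

lemma rim_is_cycle:
  assumes "3 \<le> n" and rims: "\<And>k. k < n \<Longrightarrow> rim n ((j + k) mod n) \<in> B"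
  shows "is_cycle \<lparr>verts = verts (wheel n), edges = B\<rparr> (rim_walk n j n)"
proof -
  have "{last (rim_walk n j n), hd (rim_walk n j n)} = rim n ((j + (n - 1)) mod n)"
    using assms(1) by (simp add: rim_walk_def last_map hd_map rim_def mod_Suc_eq)
  then show ?thesis
    using assms(1) rims[of "n - 1"] rim_walk_is_path[of n n j B] rims
    by (simp add: is_cycle_def rim_walk_def)
qed

lemma fan_is_cycle:
  assumes l: "1 \<le> l" "l < n" and spokes: "spoke (j mod n) \<in> B" "spoke ((j + l) mod n) \<in> B"
    and rims: "\<And>k. k < l \<Longrightarrow> rim n ((j + k) mod n) \<in> B"
  shows "is_cycle \<lparr>verts = verts (wheel n), edges = B\<rparr> (Hub # rim_walk n j (Suc l))"
proof -
  have ends: "hd (rim_walk n j (Suc l)) = Rim (j mod n)"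
    "last (rim_walk n j (Suc l)) = Rim ((j + l) mod n)"
    by (simp_all add: rim_walk_def hd_map del: upt_Suc) (simp add: last_map)
  have "Hub \<notin> set (rim_walk n j (Suc l))" "length (rim_walk n j (Suc l)) = Suc l"
    by (auto simp: rim_walk_def)
  then show ?thesis
    using rim_walk_is_path[of "Suc l" n j B] l rims spokes ends
    by (auto simp: is_cycle_def is_path_def successively_Cons spoke_def insert_commute wheel_def)
qed

lemma base_fan_has_gap:
  assumes n: "3 \<le> n" and B: "B \<in> bases (whirl n)"
    and spokes: "spoke (j mod n) \<in> B" "spoke ((j + l) mod n) \<in> B" and l: "1 \<le> l" "l \<le> n"
  shows "\<exists>k<l. rim n ((j + k) mod n) \<notin> B"
proof (rule ccontr)
  assume "\<not> ?thesis"
  then have rims: "rim n ((j + k) mod n) \<in> B" if "k < l" for k using that by blast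
  show False
    using rim_is_cycle[OF n, of j B] fan_is_cycle[OF l(1) _ spokes] rims l(2)
      base_with_spoke_acyclic[OF B spokes(1)]
    by (cases "l = n") auto
qed

section \<open>The base-cobases of the whirl\<close>

lemma last_different_index:
  fixes i b :: nat
  assumes "b < i" "s b \<noteq> s i"
  obtains a where "b \<le> a" "a < i" "s a \<noteq> s i" "\<And>k. a < k \<Longrightarrow> k \<le> i \<Longrightarrow> s k = s i"
proof -
  let ?P = "\<lambda>a. a < i \<and> s a \<noteq> s i"
  let ?a = "GREATEST a. ?P a"
  have bound: "k \<le> i" if "?P k" for k using that by simp
  have "?P b" using assms by simp
  then have "?P ?a" using bound by (rule GreatestI_nat)
  have max: "k \<le> ?a" if "?P k" for k using that bound by (rule Greatest_le_nat)
  have "s k = s i" if "?a < k" "k \<le> i" for k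
  proof (cases "k = i")
    case False
    then show ?thesis using max[of k] that by auto
  qed simp
  then show thesis using that \<open>?P ?a\<close> max[OF \<open>?P b\<close>] by blast
qed

text \<open>At a change of \<open>s\<close>, the constant block since the previous change must contain a value of
  \<open>d\<close> opposite to it; as \<open>d\<close> copied its right neighbour so far, only the end of the block can
  supply it.\<close>

lemma periodic_gap_copies_right:
  fixes s d :: "nat \<Rightarrow> bool"
  assumes n: "0 < n" and per: "\<And>i. s (i + n) = s i"
    and gap: "\<And>j l. 1 \<le> l \<Longrightarrow> l \<le> n \<Longrightarrow> s (j + l) = s j \<Longrightarrow> \<exists>k<l. d (j + k) = s j"
    and j: "d j \<noteq> s j" "j \<le> i"
  shows "d i = s (Suc i)"
  using j(2)
proof (induction i rule: less_induct)
  case (less i)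
  have same: "d i = s i" if "s (Suc i) = s i" for i using gap[of 1 i] that n by auto
  then have change: "s (Suc j) \<noteq> s j" using j(1) by blast
  show ?case
  proof (cases "i = j \<or> s (Suc i) = s i")
    case True
    then show ?thesis using same j(1) change by auto
  next
    case False
    then have i: "j < i" "s (Suc i) \<noteq> s i" using less.prems by auto
    obtain b where "j \<le> b" "b < i" "s b \<noteq> s i"
    proof (cases "s j = s i")
      case True
      then have "Suc j < i" using i(1) change by (metis Suc_lessI)
      then show thesis using that[of "Suc j"] change True by simp
    qed (use i(1) that in blast)
    then obtain a where a: "j \<le> a" "a < i" "s a \<noteq> s i" "\<And>k. a < k \<Longrightarrow> k \<le> i \<Longrightarrow> s k = s i"
      using last_different_index[of b i s] by (metis le_trans)
    have "i < a + n" using a(3) a(4)[of "a + n"] per[of a] n by force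
    then have "\<exists>k < Suc i - a. d (a + k) = s a" using a(2,3) i(2) by (intro gap) auto
    then obtain k where k: "k < Suc i - a" "d (a + k) = s a" by blast
    have "a + k = i"
    proof (rule ccontr)
      assume "a + k \<noteq> i"
      then have "a + k < i" using k(1) by linarith
      then have "d (a + k) = s (Suc (a + k))" using less.IH a(1) by simp
      also have "\<dots> = s i" using \<open>a + k < i\<close> by (intro a(4)) simp_all
      finally show False using k(2) a(3) by simp
    qed
    then show ?thesis using k(2) a(3) i(2) by auto
  qed
qed

lemma periodic_gap_dichotomy:
  fixes s d :: "nat \<Rightarrow> bool"
  assumes n: "0 < n" and per: "\<And>i. s (i + n) = s i" "\<And>i. d (i + n) = d i"
    and gap: "\<And>j l. 1 \<le> l \<Longrightarrow> l \<le> n \<Longrightarrow> s (j + l) = s j \<Longrightarrow> \<exists>k<l. d (j + k) = s j"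
  shows "(\<forall>i. d i = s i) \<or> (\<forall>i. d i = s (Suc i))"
proof (cases "\<forall>i. d i = s i")
  case False
  then obtain j where j: "d j \<noteq> s j" by blast
  have per_mult: "s (i + k * n) = s i" "d (i + k * n) = d i" for i k
    using per by (induction k) (auto simp: add.assoc[symmetric] add.commute[of n])
  have "d i = s (Suc i)" for i
  proof -
    have "j \<le> i + j * n" using n by (simp add: trans_le_add2)
    with n per(1) gap j have "d (i + j * n) = s (Suc (i + j * n))"
      by (rule periodic_gap_copies_right)
    then show ?thesis using per_mult(1)[of "Suc i" j] per_mult(2)[of i j] by simp
  qed
  then show ?thesis by blast
qed simp

lemma base_cobase_rim_edges:
  assumes n: "3 \<le> n" and B: "B \<in> bases (whirl n)" "edges (wheel n) - B \<in> bases (whirl n)"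
  shows "\<exists>t. \<forall>i<n. rim n i \<in> B \<longleftrightarrow> spoke (rim_end n t i) \<notin> B"
proof -
  define s d where "s i \<longleftrightarrow> spoke (i mod n) \<in> B" and "d i \<longleftrightarrow> rim n (i mod n) \<notin> B" for i
  have all: "spoke (i mod n) \<in> edges (wheel n)" "rim n (i mod n) \<in> edges (wheel n)" for i
    using n by (auto simp: edges_wheel wheel_edges_eq)
  have "\<exists>k<l. d (j + k) = s j" if "1 \<le> l" "l \<le> n" "s (j + l) = s j" for j l
  proof (cases "s j")
    case True
    then show ?thesis using base_fan_has_gap[OF n B(1), of j l] that by (auto simp: s_def d_def)
  next
    case False
    then show ?thesis
      using base_fan_has_gap[OF n B(2), of j l] that all by (auto simp: s_def d_def)
  qed
  then consider "\<And>i. d i = s i" | "\<And>i. d i = s (Suc i)"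
    using periodic_gap_dichotomy[of n s d] n by (auto simp: s_def d_def)
  then show ?thesis
  proof cases
    case 1
    have "rim n i \<in> B \<longleftrightarrow> spoke i \<notin> B" if "i < n" for i
      using 1[of i] that by (auto simp: s_def d_def)
    then show ?thesis by (intro exI[of _ False]) (simp add: rim_end_def)
  next
    case 2
    have "rim n i \<in> B \<longleftrightarrow> spoke (Suc i mod n) \<notin> B" if "i < n" for i
      using 2[of i] that by (auto simp: s_def d_def)
    then show ?thesis by (intro exI[of _ True]) (simp add: rim_end_def)
  qed
qed

lemma bases_whirl_subset: "bases (whirl n) \<subseteq> Pow (ground (whirl n))"
  by (auto simp: whirl_def spanning_trees_def wheel_def)

definition whirl_bases :: "nat \<Rightarrow> nat set \<Rightarrow> wheel_vertex set set set" where
  "whirl_bases n A = (\<Union>t. whirl_base n t ` Pow A)"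

lemma base_cobases_whirl:
  assumes n: "3 \<le> n"
  shows "base_cobases (whirl n) = whirl_bases n {..<n}"
  unfolding whirl_bases_def
proof (intro set_eqI iffI)
  fix B assume "B \<in> (\<Union>t. whirl_base n t ` Pow {..<n})"
  then obtain t S where B: "B = whirl_base n t S" "S \<subseteq> {..<n}" by blast
  have "ground (whirl n) - B = whirl_base n t ({..<n} - S)"
    unfolding B(1) whirl_base_complement[OF n B(2), symmetric] by (simp add: whirl_def)
  then show "B \<in> base_cobases (whirl n)"
    using whirl_base_in_bases B by (simp add: base_cobases_def)
next
  fix B assume "B \<in> base_cobases (whirl n)"
  then have B: "B \<in> bases (whirl n)" "edges (wheel n) - B \<in> bases (whirl n)"
    by (auto simp: base_cobases_def whirl_def)
  obtain t where t: "\<And>i. i < n \<Longrightarrow> rim n i \<in> B \<longleftrightarrow> spoke (rim_end n t i) \<notin> B"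
    using base_cobase_rim_edges[OF n B] by blast
  let ?S = "{i \<in> {..<n}. spoke i \<in> B}"
  have "{i \<in> {..<n}. rim n i \<in> B} = uncovered n t ?S"
    using t rim_end_less by (auto simp: uncovered_def)
  then have "B = whirl_base n t ?S"
    unfolding whirl_base_def using wheel_edges_exhaust[of B n] B(1) bases_whirl_subset[of n]
    by (auto simp: whirl_def)
  then show "B \<in> (\<Union>t. whirl_base n t ` Pow {..<n})" by blast
qed

lemma spoke_in_whirl_base: "spoke i \<in> whirl_base n t S \<longleftrightarrow> i \<in> S"
  by (simp add: whirl_base_def spoke_in_wheel_edges)

lemma inj_whirl_base: "inj (whirl_base n t)"
  by (rule injI) (metis spoke_in_whirl_base subsetI subset_antisym)

lemma rotation_closed_cases:
  assumes S: "S \<subseteq> {..<n}" and closed: "\<And>i. i \<in> S \<Longrightarrow> Suc i mod n \<in> S"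
  shows "S = {} \<or> S = {..<n}"
proof (cases "S = {}")
  case False
  then obtain i where i: "i \<in> S" by blast
  have "j \<in> S" if "j < n" for j
  proof -
    have "i < n" using i S by blast
    then obtain k where k: "(rim_step n False ^^ k) i = j"
      using ex_rim_step_funpow[OF \<open>i < n\<close> \<open>j < n\<close>] by blast
    have "(rim_step n False ^^ k) i \<in> S" by (induction k) (simp_all add: i closed rim_step_def)
    then show ?thesis using k by simp
  qed
  then show ?thesis using S by blast
qed simp

lemma whirl_base_eq_iff:
  assumes n: "3 \<le> n" and S: "S \<subseteq> {..<n}" and T: "T \<subseteq> {..<n}"
  shows "whirl_base n s S = whirl_base n t T \<longleftrightarrow> S = T \<and> (s = t \<or> S = {} \<or> S = {..<n})"
proof -
  have uncovered_eq: "uncovered n True S = uncovered n False S \<longleftrightarrow> S = {} \<or> S = {..<n}"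
  proof
    assume eq: "uncovered n True S = uncovered n False S"
    show "S = {} \<or> S = {..<n}"
    proof (rule rotation_closed_cases[OF S])
      fix i assume "i \<in> S"
      then have "i < n" "i \<notin> uncovered n True S"
        using S eq by (auto simp: uncovered_def rim_end_def)
      then show "Suc i mod n \<in> S" by (simp add: uncovered_def rim_end_def)
    qed
  qed (auto simp: uncovered_def rim_end_def)
  have "whirl_base n s S = whirl_base n t T \<longleftrightarrow> S = T \<and> uncovered n s S = uncovered n t S"
    unfolding whirl_base_def
    using wheel_edges_eq_iff[OF n S uncovered_subset T uncovered_subset] by auto
  also have "uncovered n s S = uncovered n t S \<longleftrightarrow> s = t \<or> S = {} \<or> S = {..<n}"
    using uncovered_eq by (cases s; cases t) auto
  finally show ?thesis .
qed

section \<open>Adjacency of base-cobases\<close>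

lemma edge_base_cobase_graph_iff:
  "{A, B} \<in> edges (base_cobase_graph M) \<longleftrightarrow>
     A \<in> base_cobases M \<and> B \<in> base_cobases M \<and> card (sym_diff A B) = 2"
  by (auto simp: base_cobase_graph_def doubleton_eq_iff Un_commute)

lemma whirl_bases_adjacent_iff:
  assumes n: "3 \<le> n" and S: "S \<subseteq> {..<n}" "T \<subseteq> {..<n}"
  shows "{whirl_base n s S, whirl_base n t T} \<in> edges (base_cobase_graph (whirl n)) \<longleftrightarrow>
    card (sym_diff S T) + card (sym_diff (uncovered n s S) (uncovered n t T)) = 2"
proof -
  have "whirl_base n s S \<in> base_cobases (whirl n)" "whirl_base n t T \<in> base_cobases (whirl n)"
    unfolding base_cobases_whirl[OF n] whirl_bases_def using S by blast+
  then show ?thesis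
    unfolding edge_base_cobase_graph_iff whirl_base_def
    by (simp add: card_sym_diff_wheel_edges[OF n S(1) uncovered_subset S(2) uncovered_subset])
qed

lemma whirl_base_adjacent_insert:
  assumes n: "3 \<le> n" and i: "i \<in> {..<n} - S" and S: "S \<subseteq> {..<n}"
  shows "{whirl_base n t S, whirl_base n t (insert i S)} \<in> edges (base_cobase_graph (whirl n))"
proof -
  have bij: "bij_betw (rim_end n t) {..<n} {..<n}" by (rule bij_betw_rim_end)
  obtain j where j: "j \<in> {..<n}" "rim_end n t j = i"
    using i bij_betw_imp_surj_on[OF bij] by (metis DiffD1 imageE)
  have "sym_diff (uncovered n t S) (uncovered n t (insert i S)) = {k \<in> {..<n}. rim_end n t k = i}"
    using i by (auto simp: uncovered_def)
  also have "\<dots> = {j}" using j bij_betw_imp_inj_on[OF bij] by (auto dest: inj_onD)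
  finally have "sym_diff (uncovered n t S) (uncovered n t (insert i S)) = {j}" .
  moreover have "sym_diff S (insert i S) = {i}" using i by blast
  ultimately show ?thesis using i S by (subst whirl_bases_adjacent_iff[OF n]) auto
qed

lemma whirl_base_adjacent_interval:
  assumes n: "3 \<le> n" and ab: "a < b" "b < n"
  shows "{whirl_base n False {a..<b}, whirl_base n True {a..<b}}
    \<in> edges (base_cobase_graph (whirl n))"
proof -
  have "sym_diff (uncovered n False {a..<b}) (uncovered n True {a..<b})
      = {i \<in> {..<n}. i \<in> {a..<b} \<longleftrightarrow> Suc i mod n \<notin> {a..<b}}"
    by (auto simp: uncovered_def rim_end_def)
  also have "\<dots> = {b - 1, if a = 0 then n - 1 else a - 1}"
    using ab by (auto simp: mod_Suc split: if_splits)
  also have "card \<dots> = 2" using ab by auto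
  finally show ?thesis using ab by (subst whirl_bases_adjacent_iff[OF n]) auto
qed

lemma complement_base_cobases:
  "bases M \<subseteq> Pow (ground M) \<Longrightarrow> A \<in> base_cobases M \<Longrightarrow> ground M - A \<in> base_cobases M"
  by (auto simp: base_cobases_def double_diff)

lemma complement_base_cobase_graph_edge:
  assumes M: "bases M \<subseteq> Pow (ground M)" and e: "e \<in> edges (base_cobase_graph M)"
  shows "(\<lambda>A. ground M - A) ` e \<in> edges (base_cobase_graph M)"
proof -
  obtain A B where AB: "e = {A, B}" "A \<in> base_cobases M" "B \<in> base_cobases M"
    "card (sym_diff A B) = 2"
    using e by (auto simp: base_cobase_graph_def)
  then have "A \<subseteq> ground M" "B \<subseteq> ground M" using M by (auto simp: base_cobases_def)
  then have "sym_diff (ground M - A) (ground M - B) = sym_diff A B" by blast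
  then show ?thesis
    using AB complement_base_cobases[OF M] by (simp add: edge_base_cobase_graph_iff)
qed

lemma glued_cubes_whirl:
  assumes "3 \<le> n"
  shows "glued_cubes (edges (base_cobase_graph (whirl n))) (whirl_base n) {..<n - 1} 0 1"
proof
  show "finite {..<n - 1}" "{0, 1} \<subseteq> {..<n - 1}" "(0::nat) \<noteq> 1"
    using assms by auto
  show "whirl_base n s S = whirl_base n t T \<longleftrightarrow> S = T \<and> (s = t \<or> S = {})"
    if "S \<subseteq> {..<n - 1}" "T \<subseteq> {..<n - 1}" for S T s t
  proof -
    have "S \<subseteq> {..<n}" "T \<subseteq> {..<n}" "S \<noteq> {..<n}" using that assms by force+
    then show ?thesis by (simp add: whirl_base_eq_iff[OF assms])
  qed
  show "cube_edges (whirl_base n t) {..<n - 1} \<subseteq> edges (base_cobase_graph (whirl n))" for t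
    by (auto simp: cube_edges_def intro!: whirl_base_adjacent_insert[OF assms])
  show "{whirl_base n False S, whirl_base n True S} \<in> edges (base_cobase_graph (whirl n))"
    if "S \<in> {{0}, {1}, {0, 1}}" for S
  proof -
    have "{0..<1::nat} = {0}" "{1..<2::nat} = {1}" "{0..<2::nat} = {0, 1}" by auto
    then show ?thesis
      using that assms whirl_base_adjacent_interval[OF assms, of 0 1]
        whirl_base_adjacent_interval[OF assms, of 1 2]
        whirl_base_adjacent_interval[OF assms, of 0 2]
      by auto
  qed
qed

section \<open>Joining the two complementary halves\<close>

lemma ham_connected_lower_half:
  assumes "3 \<le> n"
  shows "ham_connected_through (edges (base_cobase_graph (whirl n))) (whirl_bases n {..<n - 1})
    {bicoloured (whirl_base n False) (Pow {..<n - 1}) even_card}"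
proof -
  interpret glued_cubes "edges (base_cobase_graph (whirl n))" "whirl_base n" "{..<n - 1}" 0 1
    by (rule glued_cubes_whirl[OF assms])
  from ham_connected_vertices[OF ab_subset order_refl] show ?thesis
    unfolding vertices_def cube_pairs_def whirl_bases_def by (rule ham_connected_through_mono) simp
qed

lemma complement_lower_half:
  assumes "3 \<le> n"
  shows "(-) (ground (whirl n)) ` whirl_bases n {..<n - 1}
    = (\<Union>t. (whirl_base n t \<circ> insert (n - 1)) ` Pow {..<n - 1})"
proof -
  let ?A = "{..<n - 1}"
  have "(-) (ground (whirl n)) ` whirl_base n t ` Pow ?A
      = (whirl_base n t \<circ> insert (n - 1)) ` Pow ?A" for t
  proof -
    have "ground (whirl n) - whirl_base n t S = whirl_base n t (insert (n - 1) (?A - S))"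
      if "S \<in> Pow ?A" for S
    proof -
      have "S \<subseteq> {..<n}" "{..<n} - S = insert (n - 1) (?A - S)" using that assms by force+
      then show ?thesis using whirl_base_complement[OF assms, of S t] by (simp add: whirl_def)
    qed
    then have "(-) (ground (whirl n)) ` whirl_base n t ` Pow ?A
        = (whirl_base n t \<circ> insert (n - 1)) ` (-) ?A ` Pow ?A"
      unfolding image_image by (intro image_cong) simp_all
    also have "(-) ?A ` Pow ?A = Pow ?A"
      by (force simp: double_diff intro!: image_eqI[of _ _ "?A - _"])
    finally show ?thesis .
  qed
  then show ?thesis by (simp add: whirl_bases_def image_UN)
qed

lemma base_cobases_whirl_halves:
  assumes "3 \<le> n"
  shows "base_cobases (whirl n)
    = whirl_bases n {..<n - 1} \<union> (-) (ground (whirl n)) ` whirl_bases n {..<n - 1}"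
proof -
  have "{..<n} = insert (n - 1) {..<n - 1}" using assms by force
  then have "base_cobases (whirl n) = whirl_bases n (insert (n - 1) {..<n - 1})"
    using base_cobases_whirl[OF assms] by metis
  then show ?thesis
    unfolding complement_lower_half[OF assms] by (auto simp: whirl_bases_def image_Pow_insert)
qed

lemma whirl_halves_disjoint:
  assumes "3 \<le> n"
  shows "whirl_bases n {..<n - 1} \<inter> (-) (ground (whirl n)) ` whirl_bases n {..<n - 1} = {}"
proof -
  have "spoke (n - 1) \<notin> B" if "B \<in> whirl_bases n {..<n - 1}" for B
    using that by (auto simp: whirl_bases_def spoke_in_whirl_base)
  moreover have "spoke (n - 1) \<in> B"
    if "B \<in> (-) (ground (whirl n)) ` whirl_bases n {..<n - 1}" for B
    using that unfolding complement_lower_half[OF assms] by (auto simp: spoke_in_whirl_base)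
  ultimately show ?thesis by blast
qed

lemma ham_connected_base_cobases_whirl:
  assumes "3 \<le> n"
  shows "ham_connected_through (edges (base_cobase_graph (whirl n))) (base_cobases (whirl n)) {}"
proof -
  let ?E = "edges (base_cobase_graph (whirl n))" and ?V = "whirl_bases n {..<n - 1}"
  let ?\<sigma> = "(-) (ground (whirl n))" and ?h = "whirl_base n False" and ?K = "Pow {..<n - 1}"
  let ?f = "?h \<circ> insert (n - 1)"
  note halves = base_cobases_whirl_halves[OF assms]
  show ?thesis
    unfolding halves
  proof (rule ham_connected_Un_mirror[OF ham_connected_lower_half[OF assms]])
    show "?\<sigma> (?\<sigma> B) = B" if "B \<in> ?V" for B
      using that halves bases_whirl_subset by (auto simp: base_cobases_def double_diff)
    show "?\<sigma> ` e \<in> ?E" if "e \<in> ?E" for e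
      using complement_base_cobase_graph_edge[OF bases_whirl_subset that] .
    show "?V \<inter> ?\<sigma> ` ?V = {}" by (rule whirl_halves_disjoint[OF assms])
    show "inj_on ?h ?K" by (rule inj_on_subset[OF inj_whirl_base]) simp
    show "inj_on ?f ?K"
      by (rule inj_on_Pow_insert(2)[OF inj_on_subset[OF inj_whirl_base]]) simp_all
    show "?h ` ?K \<subseteq> ?V" "?f ` ?K \<subseteq> ?\<sigma> ` ?V"
      unfolding complement_lower_half[OF assms] unfolding whirl_bases_def by blast+
    show "{?h S, ?f S} \<in> ?E" if "S \<in> ?K" for S
      using whirl_base_adjacent_insert[OF assms, of "n - 1" S] that assms by force
    have "2 \<le> n - 1" using assms by simp
    from power_increasing[OF this, of "2::nat"] show "3 \<le> card ?K" by (simp add: card_Pow)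
  qed
qed

theorem theorem4p9:
  fixes n :: nat
  assumes "n \<ge> 3"
  shows "hamiltonian_connected (base_cobase_graph (whirl n))"
proof (rule hamiltonian_connected_if_ham_connected_through)
  have "verts (base_cobase_graph (whirl n)) = base_cobases (whirl n)"
    by (simp add: base_cobase_graph_def)
  then show "ham_connected_through (edges (base_cobase_graph (whirl n)))
      (verts (base_cobase_graph (whirl n))) {}"
    using ham_connected_base_cobases_whirl[OF assms] by simp
qed

end
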